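(* Consider the rod with hardening under the assumptions of the context, in either Case A (expanding elastic range) or Case B (linear kinematic hardening). Let $(y,\xi)$ be a solution of the sweeping process $$-\frac{d}{dt}\begin{pmatrix}\bm y\\ \bm\xi\end{pmatrix}\in N^{\widehat{\mathbf C}^{-1}}_{\widehat{\mathcal C}(t)}\begin{pmatrix}\bm y\\ \bm\xi\end{pmatrix},\qquad\widehat{\mathcal C}(t)=\left(\widehat\Sigma-\begin{pmatrix}\bm{\widetilde\sigma}(t)\\0\end{pmatrix}\right)\cap(\mathcal{V}\times L^2(\Omega)).$$ Then the right-hand side of the inclusion $$\frac{d}{dt}\bm\varepsilon\in\mathbf{C}^{-1}\left(P_1\left(\left(N^{\widehat{\mathbf C}^{-1}}_{\widehat\Sigma-\begin{pmatrix}\bm{\widetilde\sigma}(t)\\0\end{pmatrix}}\begin{pmatrix}\bm y\\ \bm\xi\end{pmatrix}+\frac{d}{dt}\begin{pmatrix}\bm y\\ \bm\xi\end{pmatrix}\right)\cap(\mathcal{U}\times\{0\})\right)+\frac{d}{dt}\bm{\widetilde\sigma}(t)\right)$$ is nonempty for a.a. $t\in I$.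
   Context: $\Omega=(a,b)$, $a<b$, $I=[0,T]$, $T>0$. The stiffness $\bm C\in L^\infty(\Omega)$ satisfies $0<c_0\le\bm C(x)\le C_0$ for a.a. $x\in\Omega$, and $\mathbf{C}:L^2(\Omega)\to L^2(\Omega)$ is multiplication by $\bm C$. $L^2_{\mathbf{C}^{-1}}(\Omega)$ is $L^2(\Omega)$ with the inner product $\int_\Omega\frac{\tau_1\tau_2}{\bm C}\,dx$. $\mathcal{V}\subset L^2_{\mathbf{C}^{-1}}(\Omega)$ is the subspace of (a.e.) constant functions and $\mathcal{U}=\{\bm\sigma\in L^2_{\mathbf{C}^{-1}}(\Omega):\int_\Omega\frac{\sigma(x)}{\bm C(x)}\,dx=0\}$ its orthogonal complement. $N^{\widehat{\mathbf C}^{-1}}$ is the normal cone in the product Hilbert space $L^2_{\mathbf{C}^{-1}}(\Omega)\times L^2(\Omega)$, where $N_{\mathcal C}(\bm x)=\{\bm z:\langle\bm z,\bm c-\bm x\rangle\le0\ \forall\bm c\in\mathcal{C}\}$ for $\bm x\in\mathcal C$; $P_1(\bm\sigma,\bm\xi)=\bm\sigma$. The loads are $u_a,u_b\in W^{1,\infty}(I)$ (with $a+u_a(t)<b+u_b(t)$ for all $t>0$) and $F\in W^{1,\infty}(I,L^2(\Omega))$; the stress solution for elasticity $\widetilde\sigma\in W^{1,\infty}(I,L^2(\Omega))$ is $$\widetilde\sigma(t,x)=\omega_0\left(u_b(t)-u_a(t)+\int_\Omega\frac{1}{\bm C(z)}\int_a^zF(t,y)\,dy\,dz\right)-\int_a^xF(t,y)\,dy,\qquad\omega_0=\left(\int_\Omega\frac{dy}{\bm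 C(y)}\right)^{-1}.$$ A solution of the sweeping process is a function $(y,\xi):I\to L^2_{\mathbf{C}^{-1}}(\Omega)\times L^2(\Omega)$ with a prescribed initial value $(\bm y(0),\bm\xi(0))=(\bm\sigma_{\bf 0}-\bm{\widetilde\sigma}(0),\bm\xi_{\bf 0})\in\widehat{\mathcal C}(0)$, $(\bm y(t),\bm\xi(t))\in\widehat{\mathcal C}(t)$ for all $t\in I$, and such that the derivative exists and the inclusion holds for a.a. $t\in I$. The yield limits are functions $(x,\xi)\in\Omega\times\mathbb{R}\mapsto\sigma^-_x(\xi)\in\mathbb{R}$ and $(x,\xi)\mapsto\sigma^+_x(\xi)\in\mathbb{R}$ and $$\widehat\Sigma=\left\{\begin{pmatrix}\bm\sigma\\ \bm\xi\end{pmatrix}\in L^2(\Omega)\times L^2(\Omega):\sigma^-_x(\xi(x))\le\sigma(x)\le\sigma^+_x(\xi(x))\text{ for a.a. }x\in\Omega\right\}.$$ For a.a. $x\in\Omega$, $\xi\mapsto\sigma^-_x(\xi)$ is convex, strictly monotone and surjective onto $\mathbb{R}$, and $\xi\mapsto\sigma^+_x(\xi)$ is concave, strictly monotone and surjective onto $\mathbb{R}$. The initial value satisfies $\sigma^-_x(\xi_{\bf 0}(x))<\sigma^+_x(\xi_{\bf 0}(x))$ for a.a. $x\in\Omega$. Case A (expanding elastic range, e.g. nonlinear isotropic hardening). For a.a. $x$, $\sigma^+_x$ is increasing and $\sigma^-_x$ is decreasing in $\xi$; $\xi^+_x,\xi^-_x:\mathbb{R}\to\mathbb{R}$ denote the inverse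 functions of $\sigma^+_x,\sigma^-_x$. For each $\xi\in\mathbb{R}$ the maps $x\mapsto\sigma^\pm_x(\xi)$ are Lebesgue-measurable (so that $(x,\sigma)\mapsto\xi^\pm_x(\sigma)$ are Carathéodory functions). There exist $\psi\in L^2(\Omega)$ and $c>0$ such that for a.a. $x\in\Omega$ and all $\sigma\in\mathbb{R}$, $\max(|\xi^-_x(\sigma)|,|\xi^+_x(\sigma)|)\le\psi(x)+c|\sigma|$. Case B (linear kinematic hardening). $\sigma^\pm_x(\xi)=\sigma^\pm_{\rm offset}(x)+\bm H(x)\xi$ with $\sigma^\pm_{\rm offset}\in L^\infty(\Omega)$, $\bm H\in L^\infty(\Omega)$, and there is $\eta\in\mathbb R$ with $0<\eta\le\bm H(x)$ for a.a. $x\in\Omega$. *)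

theory Defs
  imports "HOL-Analysis.Analysis" "HOL-Library.Function_Algebras"
begin

text \<open>
  Elements of Lebesgue spaces over a complete measure space \<open>M\<close> are represented by functions.
  Equality in these spaces is equality almost everywhere, and the subsets of \<open>L2 M\<close> and
  \<open>L2 M \<times> L2 M\<close> defined below are closed under changing a representative on a null set.
\<close>

definition L2 :: "'x measure \<Rightarrow> ('x \<Rightarrow> real) set" where
  "L2 M = {f \<in> borel_measurable M. integrable M (\<lambda>x. (f x)\<^sup>2)}"

definition Linf :: "'x measure \<Rightarrow> ('x \<Rightarrow> real) set" where
  "Linf M = {f \<in> borel_measurable M. \<exists>K. AE x in M. \<bar>f x\<bar> \<le> K}"

text \<open>
  The argument \<open>w\<close> is the stiffness: \<open>w = C\<close> gives the inner product with weight \<open>1/C\<close>, and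
  \<open>w = (\<lambda>_. 1)\<close> gives the usual one.  For \<open>w\<close> measurable and bounded between two positive constants,
  the underlying space is \<open>L2 M\<close> in both cases.
\<close>

definition L2_inner :: "'x measure \<Rightarrow> ('x \<Rightarrow> real) \<Rightarrow> ('x \<Rightarrow> real) \<Rightarrow> ('x \<Rightarrow> real) \<Rightarrow> real" where
  "L2_inner M w f g = (\<integral>x. f x * g x / w x \<partial>M)"

definition L2_norm :: "'x measure \<Rightarrow> ('x \<Rightarrow> real) \<Rightarrow> ('x \<Rightarrow> real) \<Rightarrow> real" where
  "L2_norm M w f = sqrt (L2_inner M w f f)"

definition prod_inner ::
  "'x measure \<Rightarrow> ('x \<Rightarrow> real) \<Rightarrow> ('x \<Rightarrow> real) \<times> ('x \<Rightarrow> real) \<Rightarrow> ('x \<Rightarrow> real) \<times> ('x \<Rightarrow> real) \<Rightarrow> real" where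
  "prod_inner M C p q = L2_inner M C (fst p) (fst q) + L2_inner M (\<lambda>_. 1) (snd p) (snd q)"

text \<open>Normal cone in the product space; it is empty at points outside the set.\<close>

definition normal_cone ::
  "'x measure \<Rightarrow> ('x \<Rightarrow> real) \<Rightarrow> (('x \<Rightarrow> real) \<times> ('x \<Rightarrow> real)) set \<Rightarrow> ('x \<Rightarrow> real) \<times> ('x \<Rightarrow> real)
    \<Rightarrow> (('x \<Rightarrow> real) \<times> ('x \<Rightarrow> real)) set" where
  "normal_cone M C K p =
     {z \<in> L2 M \<times> L2 M. p \<in> K \<and> (\<forall>c\<in>K. prod_inner M C z (c - p) \<le> 0)}"

text \<open>Norm derivative at \<open>t\<close>; only meaningful if \<open>f s \<in> L2 M\<close> for all \<open>s \<in> I\<close>.\<close>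

definition has_L2_derivative ::
  "'x measure \<Rightarrow> ('x \<Rightarrow> real) \<Rightarrow> real set \<Rightarrow> (real \<Rightarrow> 'x \<Rightarrow> real) \<Rightarrow> ('x \<Rightarrow> real) \<Rightarrow> real \<Rightarrow> bool" where
  "has_L2_derivative M w I f g t \<longleftrightarrow>
     g \<in> L2 M \<and>
     ((\<lambda>s. L2_norm M w (\<lambda>x. (f s x - f t x) / (s - t) - g x)) \<longlongrightarrow> 0) (at t within I)"

definition abs_continuous_curve :: "('v \<Rightarrow> 'v \<Rightarrow> real) \<Rightarrow> real set \<Rightarrow> (real \<Rightarrow> 'v) \<Rightarrow> bool" where
  "abs_continuous_curve d I f \<longleftrightarrow>
     (\<forall>e>0. \<exists>\<delta>>0. \<forall>(n::nat) l r.
        (\<forall>i<n. l i \<in> I \<and> r i \<in> I \<and> l i \<le> r i) \<and>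
        (\<forall>i<n. \<forall>j<n. i \<noteq> j \<longrightarrow> {l i<..<r i} \<inter> {l j<..<r j} = {}) \<and>
        (\<Sum>i<n. r i - l i) < \<delta>
        \<longrightarrow> (\<Sum>i<n. d (f (r i)) (f (l i))) < e)"

text \<open>
  An element of \<open>W\<^sup>1\<^sup>,\<^sup>\<infinity>\<close> of an interval is identified with its absolutely continuous representative:
  it is differentiable almost everywhere and its derivative is essentially bounded.  In the
  \<open>L2\<close>-valued case strong measurability of the derivative is automatic, since it is almost everywhere
  a limit of difference quotients of a continuous curve.
\<close>

definition W1inf :: "real set \<Rightarrow> (real \<Rightarrow> real) set" where
  "W1inf I = {u. abs_continuous_curve dist I u \<and>
     (\<exists>v \<in> Linf (lebesgue_on I).
        AE t in lebesgue_on I. (u has_real_derivative v t) (at t within I))}"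

definition W1inf_L2 :: "real set \<Rightarrow> 'x measure \<Rightarrow> (real \<Rightarrow> 'x \<Rightarrow> real) set" where
  "W1inf_L2 I M = {F. (\<forall>t\<in>I. F t \<in> L2 M) \<and>
     abs_continuous_curve (\<lambda>f g. L2_norm M (\<lambda>_. 1) (\<lambda>x. f x - g x)) I F \<and>
     (\<exists>G K. AE t in lebesgue_on I.
        has_L2_derivative M (\<lambda>_. 1) I F (G t) t \<and> L2_norm M (\<lambda>_. 1) (G t) \<le> K)}"

definition ae_constants :: "'x measure \<Rightarrow> ('x \<Rightarrow> real) set" where
  "ae_constants M = {f \<in> L2 M. \<exists>k. AE x in M. f x = k}"

definition zero_mean_strains :: "'x measure \<Rightarrow> ('x \<Rightarrow> real) \<Rightarrow> ('x \<Rightarrow> real) set" where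
  "zero_mean_strains M C = {f \<in> L2 M. (\<integral>x. f x / C x \<partial>M) = 0}"

definition ae_zero :: "'x measure \<Rightarrow> ('x \<Rightarrow> real) set" where
  "ae_zero M = {f \<in> L2 M. AE x in M. f x = 0}"

definition stress_solution ::
  "real \<Rightarrow> real \<Rightarrow> (real \<Rightarrow> real) \<Rightarrow> (real \<Rightarrow> real) \<Rightarrow> (real \<Rightarrow> real) \<Rightarrow> (real \<Rightarrow> real \<Rightarrow> real)
    \<Rightarrow> real \<Rightarrow> real \<Rightarrow> real" where
  "stress_solution a b C ua ub F t x =
     inverse (LINT y:{a<..<b}|lebesgue. 1 / C y) *
       (ub t - ua t +
         (LINT z:{a<..<b}|lebesgue. 1 / C z * (LINT y:{a<..<z}|lebesgue. F t y)))
     - (LINT y:{a<..<x}|lebesgue. F t y)"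

definition yield_set ::
  "'x measure \<Rightarrow> ('x \<Rightarrow> real \<Rightarrow> real) \<Rightarrow> ('x \<Rightarrow> real \<Rightarrow> real) \<Rightarrow> (('x \<Rightarrow> real) \<times> ('x \<Rightarrow> real)) set" where
  "yield_set M sm sp =
     {(\<sigma>, \<xi>). \<sigma> \<in> L2 M \<and> \<xi> \<in> L2 M \<and> (AE x in M. sm x (\<xi> x) \<le> \<sigma> x \<and> \<sigma> x \<le> sp x (\<xi> x))}"

text \<open>The set \<open>S - (\<tau>, 0)\<close>.\<close>

definition shift_stress ::
  "(('x \<Rightarrow> real) \<times> ('x \<Rightarrow> real)) set \<Rightarrow> ('x \<Rightarrow> real) \<Rightarrow> (('x \<Rightarrow> real) \<times> ('x \<Rightarrow> real)) set" where
  "shift_stress S \<tau> = (\<lambda>p. p - (\<tau>, 0)) ` S"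

definition moving_set ::
  "'x measure \<Rightarrow> (('x \<Rightarrow> real) \<times> ('x \<Rightarrow> real)) set \<Rightarrow> (real \<Rightarrow> 'x \<Rightarrow> real) \<Rightarrow> real
    \<Rightarrow> (('x \<Rightarrow> real) \<times> ('x \<Rightarrow> real)) set" where
  "moving_set M S \<tau> t = shift_stress S (\<tau> t) \<inter> (ae_constants M \<times> L2 M)"

definition expanding_elastic_range ::
  "'x measure \<Rightarrow> ('x \<Rightarrow> real \<Rightarrow> real) \<Rightarrow> ('x \<Rightarrow> real \<Rightarrow> real) \<Rightarrow> bool" where
  "expanding_elastic_range M sm sp \<longleftrightarrow>
     (AE x in M. mono (sp x) \<and> antimono (sm x)) \<and>
     (\<forall>\<xi>. (\<lambda>x. sm x \<xi>) \<in> borel_measurable M \<and> (\<lambda>x. sp x \<xi>) \<in> borel_measurable M) \<and>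
     (\<exists>\<psi>\<in>L2 M. \<exists>c>0. AE x in M. \<forall>\<sigma>.
        max \<bar>inv (sm x) \<sigma>\<bar> \<bar>inv (sp x) \<sigma>\<bar> \<le> \<psi> x + c * \<bar>\<sigma>\<bar>)"

definition linear_kinematic_hardening ::
  "'x measure \<Rightarrow> ('x \<Rightarrow> real \<Rightarrow> real) \<Rightarrow> ('x \<Rightarrow> real \<Rightarrow> real) \<Rightarrow> bool" where
  "linear_kinematic_hardening M sm sp \<longleftrightarrow>
     (\<exists>om\<in>Linf M. \<exists>op\<in>Linf M. \<exists>H\<in>Linf M. \<exists>\<eta>>0.
        (AE x in M. \<eta> \<le> H x) \<and>
        (AE x in M. \<forall>\<xi>. sm x \<xi> = om x + H x * \<xi> \<and> sp x \<xi> = op x + H x * \<xi>))"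

text \<open>
  The derivative in the product space is taken componentwise, in the norm of the respective factor.
\<close>

definition sweeping_solution ::
  "'x measure \<Rightarrow> ('x \<Rightarrow> real) \<Rightarrow> real set \<Rightarrow> (real \<Rightarrow> (('x \<Rightarrow> real) \<times> ('x \<Rightarrow> real)) set)
    \<Rightarrow> (real \<Rightarrow> 'x \<Rightarrow> real) \<Rightarrow> (real \<Rightarrow> 'x \<Rightarrow> real) \<Rightarrow> bool" where
  "sweeping_solution M C I K y \<xi> \<longleftrightarrow>
     (\<forall>t\<in>I. (y t, \<xi> t) \<in> K t) \<and>
     (AE t in lebesgue_on I. \<exists>dy d\<xi>.
        has_L2_derivative M C I y dy t \<and> has_L2_derivative M (\<lambda>_. 1) I \<xi> d\<xi> t \<and>
        - (dy, d\<xi>) \<in> normal_cone M C (K t) (y t, \<xi> t))"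

text \<open>
  The right-hand side of the inclusion for the strain rate at time \<open>t\<close>.  It collects the values for
  all representatives \<open>dy\<close>, \<open>d\<xi>\<close>, \<open>d\<tau>\<close> of the derivatives, which are unique up to null sets; in
  particular it is empty if one of the derivatives does not exist.
\<close>

definition strain_rate_set ::
  "'x measure \<Rightarrow> ('x \<Rightarrow> real) \<Rightarrow> real set \<Rightarrow> (('x \<Rightarrow> real) \<times> ('x \<Rightarrow> real)) set
    \<Rightarrow> (real \<Rightarrow> 'x \<Rightarrow> real) \<Rightarrow> (real \<Rightarrow> 'x \<Rightarrow> real) \<Rightarrow> (real \<Rightarrow> 'x \<Rightarrow> real) \<Rightarrow> real
    \<Rightarrow> ('x \<Rightarrow> real) set" where
  "strain_rate_set M C I S \<tau> y \<xi> t =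
     {e. \<exists>dy d\<xi> d\<tau>.
        has_L2_derivative M C I y dy t \<and>
        has_L2_derivative M (\<lambda>_. 1) I \<xi> d\<xi> t \<and>
        has_L2_derivative M (\<lambda>_. 1) I \<tau> d\<tau> t \<and>
        e \<in> (\<lambda>\<sigma> x. (\<sigma> x + d\<tau> x) / C x) `
              fst ` ((\<lambda>z. z + (dy, d\<xi>)) ` normal_cone M C (shift_stress S (\<tau> t)) (y t, \<xi> t)
                      \<inter> (zero_mean_strains M C \<times> ae_zero M))}"

end

theory Submission
  imports Defs
begin

text \<open>
  At a time where \<open>y\<close>, \<open>\<xi>\<close> and the elastic stress are differentiable, put \<open>\<eta> = -d\<xi>\<close> and
  \<open>m = -\<integral> dy / C\<close>. The sweeping inclusion says \<open>k m + \<integral> \<eta> (\<xi>' - \<xi>) \<le> 0\<close> whenever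
  \<open>(\<sigma> + k, \<xi>')\<close> is admissible for a constant \<open>k\<close>, and it suffices to find a multiplier \<open>w\<close> in \<open>L2\<close>
  with \<open>\<integral> w = m\<close> such that \<open>(w, \<eta>)\<close> is normal to the whole yield set: then \<open>C w + dy\<close> has mean
  zero strain and \<open>(C w, -d\<xi>)\<close> is in the normal cone. Under linear kinematic hardening
  \<open>w = -\<eta> / H\<close>. For an expanding elastic range the yield set is \<open>\<xi> \<ge> g\<^sub>x(\<sigma>)\<close> with the convex,
  Lipschitz functions \<open>g\<^sub>x = max (\<xi>\<^sup>-\<^sub>x) (\<xi>\<^sup>+\<^sub>x)\<close>; the inclusion makes \<open>m\<close> a subgradient at \<open>0\<close> of
  \<open>\<Phi> k = \<integral> -\<eta> g\<^sub>x(\<sigma> + k)\<close>, so that \<open>m\<close> lies between \<open>\<Phi>'(0-)\<close> and \<open>\<Phi>'(0+)\<close>. These are the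
  integrals of \<open>-\<eta> g\<^sub>x'(\<sigma>-)\<close> and \<open>-\<eta> g\<^sub>x'(\<sigma>+)\<close> by dominated convergence, and \<open>w\<close> is the
  corresponding convex combination of the two.
\<close>

section \<open>Square-integrable functions: closure properties and integrability of products\<close>

lemma L2_measurable [measurable_dest]: "f \<in> L2 M \<Longrightarrow> f \<in> borel_measurable M"
  by (simp add: L2_def)

lemma L2_square_integrable: "f \<in> L2 M \<Longrightarrow> integrable M (\<lambda>x. (f x)\<^sup>2)"
  by (simp add: L2_def)

lemma L2_dominated:
  assumes g: "g \<in> L2 M" and f: "f \<in> borel_measurable M" and le: "AE x in M. \<bar>f x\<bar> \<le> \<bar>g x\<bar>"
  shows "f \<in> L2 M"
proof -
  have "integrable M (\<lambda>x. (f x)\<^sup>2)"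
  proof (rule Bochner_Integration.integrable_bound[OF L2_square_integrable[OF g]])
    show "AE x in M. norm ((f x)\<^sup>2) \<le> norm ((g x)\<^sup>2)"
      using le by eventually_elim (simp add: abs_le_square_iff)
  qed (use f in measurable)
  then show ?thesis using f by (simp add: L2_def)
qed

lemma L2_scale: "f \<in> L2 M \<Longrightarrow> (\<lambda>x. c * f x) \<in> L2 M"
  by (auto simp: L2_def power_mult_distrib)

lemma L2_add:
  assumes "f \<in> L2 M" "g \<in> L2 M"
  shows "(\<lambda>x. f x + g x) \<in> L2 M"
proof -
  have [measurable]: "f \<in> borel_measurable M" "g \<in> borel_measurable M"
    using assms by (auto simp: L2_def)
  have "integrable M (\<lambda>x. (f x + g x)\<^sup>2)"
  proof (rule Bochner_Integration.integrable_bound)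
    show "integrable M (\<lambda>x. 2 * (f x)\<^sup>2 + 2 * (g x)\<^sup>2)"
      using assms by (auto simp: L2_def)
    have "(f x + g x)\<^sup>2 \<le> 2 * (f x)\<^sup>2 + 2 * (g x)\<^sup>2" for x
      using sum_squares_bound[of "f x" "g x"] by (simp add: power2_sum)
    then show "AE x in M. norm ((f x + g x)\<^sup>2) \<le> norm (2 * (f x)\<^sup>2 + 2 * (g x)\<^sup>2)"
      by (simp add: order_trans[OF _ abs_ge_self])
  qed measurable
  then show ?thesis by (simp add: L2_def)
qed

lemma L2_uminus: "f \<in> L2 M \<Longrightarrow> (\<lambda>x. - f x) \<in> L2 M"
  using L2_scale[of f M "-1"] by simp

lemma L2_diff: "f \<in> L2 M \<Longrightarrow> g \<in> L2 M \<Longrightarrow> (\<lambda>x. f x - g x) \<in> L2 M"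
  using L2_add[OF _ L2_uminus, of f M g] by simp

lemma L2_bounded_mult:
  assumes g: "g \<in> L2 M" and h: "h \<in> borel_measurable M" and le: "AE x in M. \<bar>h x\<bar> \<le> K"
  shows "(\<lambda>x. h x * g x) \<in> L2 M"
proof (rule L2_dominated[OF L2_scale[OF g, of K]])
  show "(\<lambda>x. h x * g x) \<in> borel_measurable M" using g h by measurable
  show "AE x in M. \<bar>h x * g x\<bar> \<le> \<bar>K * g x\<bar>"
    using le by eventually_elim (auto simp: abs_mult intro!: mult_right_mono)
qed

lemma L2_mult_integrable:
  assumes "f \<in> L2 M" "g \<in> L2 M"
  shows "integrable M (\<lambda>x. f x * g x)"
proof (rule Bochner_Integration.integrable_bound)
  show "integrable M (\<lambda>x. (f x)\<^sup>2 + (g x)\<^sup>2)"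
    using assms by (auto simp: L2_def)
  have "\<bar>f x * g x\<bar> \<le> (f x)\<^sup>2 + (g x)\<^sup>2" for x
    using sum_squares_bound[of "\<bar>f x\<bar>" "\<bar>g x\<bar>"] mult_nonneg_nonneg[of "\<bar>f x\<bar>" "\<bar>g x\<bar>"]
    unfolding abs_mult power2_abs mult.assoc by linarith
  then show "AE x in M. norm (f x * g x) \<le> norm ((f x)\<^sup>2 + (g x)\<^sup>2)"
    by (simp add: order_trans[OF _ abs_ge_self])
  show "(\<lambda>x. f x * g x) \<in> borel_measurable M" using assms by measurable
qed

context finite_measure
begin

lemma L2_const: "(\<lambda>_. k) \<in> L2 M"
  by (simp add: L2_def)

lemma L2_integrable: "f \<in> L2 M \<Longrightarrow> integrable M f"
  using L2_mult_integrable[OF _ L2_const[of 1]] by simp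

lemma L2_of_bounded:
  "f \<in> borel_measurable M \<Longrightarrow> AE x in M. \<bar>f x\<bar> \<le> K \<Longrightarrow> f \<in> L2 M"
  using L2_bounded_mult[OF L2_const[of 1], of f K] by simp

text \<open>Cauchy-Schwarz against the constant 1, obtained from the nonnegative variance of the
  modulus of \<open>f\<close> about its mean \<open>A / V\<close>.\<close>

lemma integral_abs_le_L2_norm:
  assumes f: "f \<in> L2 M"
  shows "(\<integral>x. \<bar>f x\<bar> \<partial>M) \<le> sqrt (measure M (space M)) * L2_norm M (\<lambda>_. 1) f"
proof -
  define V A where "V = measure M (space M)" and "A = (\<integral>x. \<bar>f x\<bar> \<partial>M)"
  note int = L2_integrable[OF f] L2_square_integrable[OF f]
  have A0: "A \<ge> 0" by (simp add: A_def)
  have "A\<^sup>2 \<le> V * (\<integral>x. (f x)\<^sup>2 \<partial>M)"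
  proof (cases "V = 0")
    case True
    then have "emeasure M (space M) = 0"
      by (simp add: V_def emeasure_eq_measure)
    then have "AE x in M. False"
      by (intro AE_I[of _ _ "space M"]) auto
    then have "A = (\<integral>x. 0 \<partial>M)"
      unfolding A_def using f by (intro integral_cong_AE) (auto simp: L2_def)
    then show ?thesis using True by simp
  next
    case False
    then have V: "V > 0" by (simp add: V_def order_less_le)
    have "0 \<le> (\<integral>x. (\<bar>f x\<bar> - A / V)\<^sup>2 \<partial>M)" by simp
    also have "\<dots> = (\<integral>x. (f x)\<^sup>2 - 2 * (A / V) * \<bar>f x\<bar> + (A / V)\<^sup>2 \<partial>M)"
      by (simp add: power2_diff algebra_simps)
    also have "\<dots> = (\<integral>x. (f x)\<^sup>2 \<partial>M) - 2 * (A / V) * A + (A / V)\<^sup>2 * V"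
      using int by (simp add: A_def V_def)
    also have "\<dots> = (\<integral>x. (f x)\<^sup>2 \<partial>M) - A\<^sup>2 / V"
      using V by (simp add: field_simps power2_eq_square)
    finally show ?thesis using V by (simp add: field_simps)
  qed
  then have "sqrt (A\<^sup>2) \<le> sqrt (V * (\<integral>x. (f x)\<^sup>2 \<partial>M))"
    by (rule real_sqrt_le_mono)
  then show ?thesis
    using A0 by (simp add: A_def[symmetric] V_def[symmetric] L2_norm_def L2_inner_def real_sqrt_mult power2_eq_square[symmetric])
qed

end

section \<open>One-sided slopes and subgradients of convex functions on the line\<close>

text \<open>The difference quotients decrease as the step shrinks to 0 from the right and stay above
  every left slope. Their limit, the right derivative, thus lies between the left and the right
  slopes at \<open>s\<close>, which is the subgradient property.\<close>

lemma convex_right_slope_tendsto: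
  fixes f :: "real \<Rightarrow> real"
  assumes f: "convex_on UNIV f"
  obtains D where "(\<lambda>n. (f (s + 1 / Suc n) - f s) / (1 / Suc n)) \<longlonglongrightarrow> D"
    and "\<And>u. D * (u - s) \<le> f u - f s"
proof -
  define q where "q = (\<lambda>n. (f (s + 1 / Suc n) - f s) / (1 / Suc n))"
  have swap: "(p - q) / (r - t) = (q - p) / (t - r)" for p q r t :: real
    by (metis minus_diff_eq minus_divide_divide)
  have slope: "(f u - f s) / (u - s) \<le> (f v - f s) / (v - s)" if "s < u" "u < v" for u v
    using convex_on_slope_le(1)[OF f _ _ that] by (metis UNIV_I swap)
  have left: "(f s - f u) / (s - u) \<le> (f v - f s) / (v - s)" if "u < s" "s < v" for u v
    using convex_on_slope_le[OF f _ _ that] by (metis UNIV_I swap order_trans)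
  have qle: "q n \<le> (f u - f s) / (u - s)" if "1 / Suc n < u - s" for n u
    unfolding q_def using slope[of "s + 1 / Suc n" u] that by simp
  have qge: "(f s - f u) / (s - u) \<le> q n" if "u < s" for n u
    unfolding q_def using left[of u "s + 1 / Suc n"] that by simp
  have "decseq q"
  proof (rule decseq_SucI)
    fix n show "q (Suc n) \<le> q n"
      using qle[of "Suc n" "s + 1 / Suc n"] by (simp add: q_def frac_less2)
  qed
  moreover have "\<And>n. f s - f (s - 1) \<le> q n"
    using qge[of "s - 1"] by simp
  ultimately obtain D where D: "q \<longlonglongrightarrow> D"
    using decseq_convergent by blast
  have "D * (u - s) \<le> f u - f s" for u
  proof (cases u s rule: linorder_cases)
    case less
    then have "(f s - f u) / (s - u) \<le> D"
      using qge by (intro LIMSEQ_le_const[OF D]) auto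
    then show ?thesis using less by (simp add: field_simps)
  next
    case greater
    \<comment> \<open>The comparison \<open>qle\<close> needs a step shorter than
      \<open>u - s\<close>, so for \<open>u > s\<close> it is used only from some index on.\<close>
    have "eventually (\<lambda>n. 1 / Suc n < u - s) sequentially"
      using order_tendstoD(2)[OF LIMSEQ_inverse_real_of_nat, of "u - s"] greater
      by (simp add: inverse_eq_divide)
    then have "eventually (\<lambda>n. q n \<le> (f u - f s) / (u - s)) sequentially"
      by eventually_elim (rule qle)
    then have "D \<le> (f u - f s) / (u - s)"
      using D by (intro tendsto_upperbound[OF D]) auto
    then show ?thesis using greater by (simp add: field_simps)
  qed simp
  with D show ?thesis using that unfolding q_def by blast
qed

text \<open>The sign \<open>e\<close> selects the side of approach. The left case is the right case
  for the reflected function \<open>f (- u)\<close>, with slopes and subgradients changing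
  sign.\<close>

lemma convex_slope_tendsto:
  fixes f :: "real \<Rightarrow> real"
  assumes f: "convex_on UNIV f" and e: "e = 1 \<or> e = -1"
  obtains D where "(\<lambda>n. (f (s + e / Suc n) - f s) / (e / Suc n)) \<longlonglongrightarrow> D"
    and "\<And>u. D * (u - s) \<le> f u - f s"
proof (cases "e = 1")
  case True
  show ?thesis
    by (rule convex_right_slope_tendsto[OF f, of s], rule that) (simp_all add: True)
next
  case False
  then have e: "e = -1" using e by simp
  define f' where "f' u = f (- u)" for u
  have "convex_on UNIV f'"
  proof (rule convex_onI)
    fix t x y :: real
    assume "0 < t" "t < 1"
    then show "f' ((1 - t) *\<^sub>R x + t *\<^sub>R y) \<le> (1 - t) * f' x + t * f' y"
      using convex_onD[OF f, of t "- x" "- y"] by (simp add: f'_def)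
  qed simp
  then obtain D where
    D: "(\<lambda>n. (f' (- s + 1 / Suc n) - f' (- s)) / (1 / Suc n)) \<longlonglongrightarrow> D"
      "\<And>u. D * (u - (- s)) \<le> f' u - f' (- s)"
    using convex_right_slope_tendsto by blast
  have "- D * (u - s) \<le> f u - f s" for u
    using D(2)[of "- u"] by (simp add: f'_def algebra_simps)
  moreover have "(\<lambda>n. (f (s + e / Suc n) - f s) / (e / Suc n)) \<longlonglongrightarrow> - D"
    using tendsto_minus[OF D(1)] by (simp add: f'_def e)
  ultimately show ?thesis using that by blast
qed

text \<open>A supporting line steeper than \<open>c\<close> would overtake the growth bound far out
  in the direction in which it rises.\<close>

lemma subgradient_bound:
  fixes f :: "real \<Rightarrow> real"
  assumes D: "\<And>u. D * (u - s) \<le> f u - f s"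
    and growth: "\<And>u. \<bar>f u\<bar> \<le> p + c * \<bar>u\<bar>"
  shows "\<bar>D\<bar> \<le> c"
proof (rule ccontr)
  assume "\<not> \<bar>D\<bar> \<le> c"
  \<comment> \<open>This \<open>r\<close> makes \<open>(\<bar>D\<bar> - c) * r\<close> exceed the
    modulus of the offset \<open>p - f s + D * s\<close> by 1; the point \<open>u\<close> below has
    modulus \<open>r\<close> and the sign of \<open>D\<close>.\<close>
  define r where "r = (\<bar>p - f s + D * s\<bar> + 1) / (\<bar>D\<bar> - c)"
  have r: "r > 0" "\<bar>D\<bar> * r - c * r > p - f s + D * s"
    using \<open>\<not> \<bar>D\<bar> \<le> c\<close> unfolding left_diff_distrib[symmetric] by (simp_all add: r_def)
  obtain u where u: "D * u = \<bar>D\<bar> * r" "\<bar>u\<bar> = r"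
  proof (cases "D \<ge> 0")
    case True
    then show ?thesis using that[of r] r by simp
  next
    case False
    then show ?thesis using that[of "- r"] r by simp
  qed
  have "D * u - D * s \<le> p + c * \<bar>u\<bar> - f s"
    using D[of u] growth[of u] by (simp add: right_diff_distrib)
  then show False using r u by simp
qed

section \<open>Multipliers for epigraphs of convex integrands\<close>

text \<open>The one-sided derivative at \<open>\<sigma> x\<close>, a pointwise limit of measurable
  quotients, is a measurable selection of subgradients. Testing the hypothesis on \<open>m\<close>
  with \<open>k = e / Suc n\<close>, dividing by the step length and passing to the limit by
  dominated convergence compares \<open>m\<close> with its integral. The factor \<open>e\<close>
  encodes an upper bound on \<open>m\<close> for \<open>e = 1\<close> and a lower bound for
  \<open>e = -1\<close>.\<close>

lemma convex_subgradient_selection: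
  fixes g :: "'x \<Rightarrow> real \<Rightarrow> real"
  assumes fin: "finite_measure M"
    and g_convex: "AE x in M. convex_on UNIV (g x)"
    and g_growth: "AE x in M. \<forall>s. \<bar>g x s\<bar> \<le> \<psi> x + c * \<bar>s\<bar>"
    and g_measurable: "\<And>f. f \<in> borel_measurable M \<Longrightarrow> (\<lambda>x. g x (f x)) \<in> borel_measurable M"
    and \<sigma>: "\<sigma> \<in> borel_measurable M" and \<mu>: "\<mu> \<in> L2 M"
    and m: "\<And>k. k * m \<le> (\<integral>x. \<mu> x * (g x (\<sigma> x + k) - g x (\<sigma> x)) \<partial>M)"
    and e: "e = 1 \<or> e = -1"
  obtains D where "D \<in> borel_measurable M" "AE x in M. \<bar>D x\<bar> \<le> c"
    "AE x in M. \<forall>u. D x * (u - \<sigma> x) \<le> g x u - g x (\<sigma> x)"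
    "e * m \<le> e * (\<integral>x. \<mu> x * D x \<partial>M)"
proof -
  interpret finite_measure M by (fact fin)
  define q where "q n x = (g x (\<sigma> x + e / Suc n) - g x (\<sigma> x)) / (e / Suc n)" for n :: nat and x
  \<comment> \<open>\<open>lim\<close> keeps \<open>D\<close> total and measurable even where the
    quotients may fail to converge, which happens only on a null set.\<close>
  define D where "D x = lim (\<lambda>n. q n x)" for x
  have [measurable]: "\<sigma> \<in> borel_measurable M" "\<mu> \<in> borel_measurable M"
    using \<sigma> \<mu> by (auto simp: L2_def)
  have [measurable]: "(\<lambda>x. g x (\<sigma> x + k)) \<in> borel_measurable M" for k
    by (rule g_measurable) measurable
  have [measurable]: "q n \<in> borel_measurable M" for n
    using g_measurable[OF \<sigma>] unfolding q_def by measurable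
  have [measurable]: "D \<in> borel_measurable M"
    unfolding D_def by measurable
  have AE: "AE x in M. (\<lambda>n. q n x) \<longlonglongrightarrow> D x \<and> \<bar>D x\<bar> \<le> c \<and> (\<forall>n. \<bar>q n x\<bar> \<le> c) \<and>
      (\<forall>u. D x * (u - \<sigma> x) \<le> g x u - g x (\<sigma> x))"
    using g_convex g_growth
  proof eventually_elim
    case (elim x)
    obtain d where d: "(\<lambda>n. q n x) \<longlonglongrightarrow> d" "\<And>u. d * (u - \<sigma> x) \<le> g x u - g x (\<sigma> x)"
      using convex_slope_tendsto[OF elim(1) e, of "\<sigma> x"] unfolding q_def by blast
    have "d = D x" using limI[OF d(1)] by (simp add: D_def)
    \<comment> \<open>Every subgradient has modulus at most \<open>c\<close>, so \<open>g x\<close>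
      is Lipschitz with constant \<open>c\<close>. This bounds the quotients and supplies the
      dominating function \<open>c * \<bar>\<mu> x\<bar>\<close>.\<close>
    have lip: "g x s - g x u \<le> c * \<bar>s - u\<bar>" for s u
    proof -
      obtain d' where d': "\<And>u. d' * (u - s) \<le> g x u - g x s"
        using convex_right_slope_tendsto[OF elim(1), of s] by blast
      have "\<bar>d'\<bar> \<le> c" using subgradient_bound[OF d'] elim(2) by blast
      then have "\<bar>d' * (u - s)\<bar> \<le> c * \<bar>s - u\<bar>"
        by (simp add: abs_mult mult_right_mono abs_minus_commute)
      then show ?thesis using d'[of u] by linarith
    qed
    have "\<bar>q n x\<bar> \<le> c" for n
    proof -
      have "\<bar>g x (\<sigma> x + e / Suc n) - g x (\<sigma> x)\<bar> \<le> c * \<bar>e / Suc n\<bar>"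
        using lip[of "\<sigma> x + e / Suc n" "\<sigma> x"] lip[of "\<sigma> x" "\<sigma> x + e / Suc n"]
        by (simp only: abs_le_iff) simp
      moreover have "\<bar>e / Suc n\<bar> > 0" using e by auto
      ultimately show ?thesis
        unfolding q_def abs_divide by (simp only: pos_divide_le_eq abs_divide)
    qed
    moreover have "\<bar>d\<bar> \<le> c" using subgradient_bound[OF d(2)] elim(2) by blast
    ultimately show ?case using d by (simp add: \<open>d = D x\<close>)
  qed
  have "(\<lambda>n. \<integral>x. \<mu> x * q n x \<partial>M) \<longlonglongrightarrow> (\<integral>x. \<mu> x * D x \<partial>M)"
  proof (rule integral_dominated_convergence)
    show "integrable M (\<lambda>x. c * \<bar>\<mu> x\<bar>)"
      using L2_integrable[OF \<mu>] by simp
    show "AE x in M. (\<lambda>n. \<mu> x * q n x) \<longlonglongrightarrow> \<mu> x * D x"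
      using AE by eventually_elim (intro tendsto_mult_left, simp)
    show "AE x in M. norm (\<mu> x * q n x) \<le> c * \<bar>\<mu> x\<bar>" for n
      using AE by eventually_elim (simp add: abs_mult mult.commute[of c] mult_left_mono)
  qed measurable
  then have lim: "(\<lambda>n. e * (\<integral>x. \<mu> x * q n x \<partial>M)) \<longlonglongrightarrow> e * (\<integral>x. \<mu> x * D x \<partial>M)"
    by (rule tendsto_mult_left)
  have "e * m \<le> e * (\<integral>x. \<mu> x * q n x \<partial>M)" for n
  proof -
    \<comment> \<open>The integrand of the hypothesis is the step \<open>e / Suc n\<close> times
      \<open>\<mu> x * q n x\<close>. Only the positive factor \<open>1 / Suc n\<close> is
      cancelled, so the sign \<open>e\<close> survives on both sides.\<close>
    have "(e / Suc n) * m \<le> (\<integral>x. (e / Suc n) * (\<mu> x * q n x) \<partial>M)"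
      using m[of "e / Suc n"] e by (auto simp: q_def)
    then have "(e * m) / Suc n \<le> (e * (\<integral>x. \<mu> x * q n x \<partial>M)) / Suc n"
      unfolding integral_mult_right_zero by simp
    then show ?thesis
      by (subst (asm) divide_le_cancel) simp
  qed
  then have "e * m \<le> e * (\<integral>x. \<mu> x * D x \<partial>M)"
    using lim by (intro LIMSEQ_le_const) auto
  with AE show ?thesis by (intro that[of D]) auto
qed

text \<open>Normality is given only for constant stress shifts \<open>k\<close>; the multiplier
  extends it to all stress variations. Varying \<open>\<xi>'\<close> alone yields the sign of
  \<open>\<eta>\<close> and complementary slackness. What remains is a scalar subgradient condition
  on \<open>m\<close>, met by \<open>- \<eta>\<close> times a measurable choice of subgradients of
  \<open>g x\<close> at \<open>\<sigma> x\<close>.\<close>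

lemma epigraph_multiplier:
  fixes g :: "'x \<Rightarrow> real \<Rightarrow> real"
  assumes fin: "finite_measure M"
    and g_convex: "AE x in M. convex_on UNIV (g x)"
    and g_growth: "AE x in M. \<forall>s. \<bar>g x s\<bar> \<le> \<psi> x + c * \<bar>s\<bar>" and \<psi>: "\<psi> \<in> L2 M"
    and g_measurable: "\<And>f. f \<in> borel_measurable M \<Longrightarrow> (\<lambda>x. g x (f x)) \<in> borel_measurable M"
    and \<sigma>: "\<sigma> \<in> L2 M" and \<xi>: "\<xi> \<in> L2 M" and above: "AE x in M. g x (\<sigma> x) \<le> \<xi> x"
    and \<eta>: "\<eta> \<in> L2 M"
    and normal: "\<And>k \<xi>'. \<xi>' \<in> L2 M \<Longrightarrow> AE x in M. g x (\<sigma> x + k) \<le> \<xi>' x \<Longrightarrow>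
        k * m + (\<integral>x. \<eta> x * (\<xi>' x - \<xi> x) \<partial>M) \<le> 0"
  obtains w where "w \<in> L2 M" "(\<integral>x. w x \<partial>M) = m"
    "\<And>\<sigma>' \<xi>'. \<sigma>' \<in> L2 M \<Longrightarrow> \<xi>' \<in> L2 M \<Longrightarrow> AE x in M. g x (\<sigma>' x) \<le> \<xi>' x \<Longrightarrow>
       (\<integral>x. w x * (\<sigma>' x - \<sigma> x) \<partial>M) + (\<integral>x. \<eta> x * (\<xi>' x - \<xi> x) \<partial>M) \<le> 0"
proof -
  interpret finite_measure M by (fact fin)
  note [measurable] = L2_measurable[OF \<sigma>] L2_measurable[OF \<xi>] L2_measurable[OF \<eta>] L2_measurable[OF \<psi>]
  have g_L2: "(\<lambda>x. g x (f x)) \<in> L2 M" if "f \<in> L2 M" for f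
  proof (rule L2_dominated)
    have "(\<lambda>x. \<bar>f x\<bar>) \<in> L2 M"
      using that by (auto simp: L2_def)
    then show "(\<lambda>x. \<psi> x + c * \<bar>f x\<bar>) \<in> L2 M"
      using L2_add[OF \<psi> L2_scale] by blast
    show "AE x in M. \<bar>g x (f x)\<bar> \<le> \<bar>\<psi> x + c * \<bar>f x\<bar>\<bar>"
      using g_growth by eventually_elim (meson abs_ge_self order_trans)
    show "(\<lambda>x. g x (f x)) \<in> borel_measurable M"
      using g_measurable[OF L2_measurable[OF that]] .
  qed
  have int: "integrable M (\<lambda>x. \<eta> x * (f x - h x))" if "f \<in> L2 M" "h \<in> L2 M" for f h
    using L2_mult_integrable[OF \<eta> L2_diff[OF that]] .
  have nonpos: "AE x in M. \<eta> x \<le> 0"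
  proof -
    \<comment> \<open>An epigraph is closed upwards, so \<open>\<xi>\<close> may be raised by the
      positive part of \<open>\<eta>\<close>; the test then bounds the integral of its square by
      0.\<close>
    define p where "p x = max 0 (\<eta> x)" for x
    have p: "p \<in> L2 M" unfolding p_def
      by (rule L2_dominated[OF \<eta>]) (auto simp: max_def)
    have "(\<integral>x. \<eta> x * ((\<xi> x + p x) - \<xi> x) \<partial>M) \<le> 0"
    proof -
      have "AE x in M. g x (\<sigma> x) \<le> \<xi> x + p x"
        using above by eventually_elim (simp add: p_def)
      then show ?thesis using normal[OF L2_add[OF \<xi> p], of 0] by simp
    qed
    moreover have eq: "\<eta> x * ((\<xi> x + p x) - \<xi> x) = (p x)\<^sup>2" for x
      by (simp add: p_def max_def power2_eq_square)
    ultimately have "(\<integral>x. (p x)\<^sup>2 \<partial>M) = 0"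
      by (simp only: eq) (intro antisym, auto)
    then have "AE x in M. (p x)\<^sup>2 = 0"
      by (subst (asm) integral_nonneg_eq_0_iff_AE) (auto simp: L2_square_integrable[OF p])
    then show ?thesis by eventually_elim (auto simp: p_def max_def split: if_splits)
  qed
  define \<mu> where "\<mu> x = - \<eta> x" for x
  have \<mu>: "\<mu> \<in> L2 M" unfolding \<mu>_def using L2_uminus[OF \<eta>] .
  \<comment> \<open>Complementary slackness: lowering \<open>\<xi>\<close> to the boundary value
    \<open>g x (\<sigma> x)\<close> is admissible, and the resulting integrand is nonnegative with
    nonpositive integral.\<close>
  have slack: "AE x in M. \<eta> x * (\<xi> x - g x (\<sigma> x)) = 0"
  proof -
    have le0: "AE x in M. 0 \<le> \<eta> x * (g x (\<sigma> x) - \<xi> x)"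
      using nonpos above by eventually_elim (simp add: mult_nonpos_nonpos)
    have "(\<integral>x. \<eta> x * (g x (\<sigma> x) - \<xi> x) \<partial>M) \<le> 0"
      using normal[OF g_L2[OF \<sigma>], of 0] by simp
    then have "(\<integral>x. \<eta> x * (g x (\<sigma> x) - \<xi> x) \<partial>M) = 0"
      using integral_nonneg_AE[OF le0] by simp
    then have "AE x in M. \<eta> x * (g x (\<sigma> x) - \<xi> x) = 0"
      using integral_nonneg_eq_0_iff_AE[OF int[OF g_L2[OF \<sigma>] \<xi>] le0] by simp
    then show ?thesis by eventually_elim auto
  qed
  \<comment> \<open>The test point is the boundary of the epigraph over \<open>\<sigma> + k\<close>;
    slackness replaces \<open>\<xi>\<close> by \<open>g x (\<sigma> x)\<close> under the factor
    \<open>\<eta>\<close>.\<close>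
  have m: "k * m \<le> (\<integral>x. \<mu> x * (g x (\<sigma> x + k) - g x (\<sigma> x)) \<partial>M)" for k
  proof -
    have \<sigma>k: "(\<lambda>x. \<sigma> x + k) \<in> L2 M" using L2_add[OF \<sigma> L2_const] .
    have "(\<integral>x. \<eta> x * (g x (\<sigma> x + k) - \<xi> x) \<partial>M) = (\<integral>x. \<eta> x * (g x (\<sigma> x + k) - g x (\<sigma> x)) \<partial>M)"
    proof (rule integral_cong_AE)
      show "AE x in M. \<eta> x * (g x (\<sigma> x + k) - \<xi> x) = \<eta> x * (g x (\<sigma> x + k) - g x (\<sigma> x))"
        using slack by eventually_elim (auto simp: algebra_simps)
    qed (use int[OF g_L2[OF \<sigma>k] \<xi>] int[OF g_L2[OF \<sigma>k] g_L2[OF \<sigma>]] in auto)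
    then show ?thesis
      using normal[OF g_L2[OF \<sigma>k], of k] by (simp add: \<mu>_def)
  qed
  note sel = convex_subgradient_selection[OF fin g_convex g_growth g_measurable L2_measurable[OF \<sigma>] \<mu> m]
  \<comment> \<open>The right derivatives \<open>P\<close> bound \<open>m\<close> from above, the
    left derivatives \<open>Q\<close> from below.\<close>
  obtain P where P: "P \<in> borel_measurable M" "AE x in M. \<bar>P x\<bar> \<le> c"
    "AE x in M. \<forall>u. P x * (u - \<sigma> x) \<le> g x u - g x (\<sigma> x)" "m \<le> (\<integral>x. \<mu> x * P x \<partial>M)"
    by (rule sel[of 1]) auto
  obtain Q where Q: "Q \<in> borel_measurable M" "AE x in M. \<bar>Q x\<bar> \<le> c"
    "AE x in M. \<forall>u. Q x * (u - \<sigma> x) \<le> g x u - g x (\<sigma> x)" "(\<integral>x. \<mu> x * Q x \<partial>M) \<le> m"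
    by (rule sel[of "-1"]) auto
  have L2P: "(\<lambda>x. \<mu> x * P x) \<in> L2 M" and L2Q: "(\<lambda>x. \<mu> x * Q x) \<in> L2 M"
    using L2_bounded_mult[OF \<mu> P(1,2)] L2_bounded_mult[OF \<mu> Q(1,2)] by (simp_all add: mult.commute)
  \<comment> \<open>As \<open>m\<close> lies between the two integrals, it is a convex combination
    of them, and the same combination of the subgradients \<open>Q x\<close> and \<open>P x\<close>
    is again a subgradient.\<close>
  obtain \<theta> :: real where \<theta>: "0 \<le> \<theta>" "\<theta> \<le> 1"
    and \<theta>m: "m = (1 - \<theta>) * (\<integral>x. \<mu> x * Q x \<partial>M) + \<theta> * (\<integral>x. \<mu> x * P x \<partial>M)"
  proof -
    have "m \<in> closed_segment (\<integral>x. \<mu> x * Q x \<partial>M) (\<integral>x. \<mu> x * P x \<partial>M)"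
      using P(4) Q(4) by (simp add: closed_segment_eq_real_ivl)
    then show ?thesis using that by (auto simp: closed_segment_def)
  qed
  define w where "w x = (1 - \<theta>) * (\<mu> x * Q x) + \<theta> * (\<mu> x * P x)" for x
  have w: "w \<in> L2 M" unfolding w_def using L2_add[OF L2_scale[OF L2Q] L2_scale[OF L2P]] .
  show ?thesis
  proof (rule that[OF w])
    show "(\<integral>x. w x \<partial>M) = m"
      using L2_integrable[OF L2P] L2_integrable[OF L2Q] by (simp add: w_def \<theta>m)
    fix \<sigma>' \<xi>' assume \<sigma>': "\<sigma>' \<in> L2 M" and \<xi>': "\<xi>' \<in> L2 M" and le: "AE x in M. g x (\<sigma>' x) \<le> \<xi>' x"
    \<comment> \<open>The inequality holds even pointwise: the subgradient inequality for
      \<open>d\<close> is multiplied by \<open>\<mu> x \<ge> 0\<close>, and slackness rewrites the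
      term in \<open>\<eta>\<close> so that the two contributions compare.\<close>
    have "AE x in M. w x * (\<sigma>' x - \<sigma> x) + \<eta> x * (\<xi>' x - \<xi> x) \<le> 0"
      using nonpos slack P(3) Q(3) le
    proof eventually_elim
      case (elim x)
      define d where "d = (1 - \<theta>) * Q x + \<theta> * P x"
      have "(1 - \<theta>) * (Q x * (\<sigma>' x - \<sigma> x)) + \<theta> * (P x * (\<sigma>' x - \<sigma> x))
          \<le> (1 - \<theta>) * (g x (\<sigma>' x) - g x (\<sigma> x)) + \<theta> * (g x (\<sigma>' x) - g x (\<sigma> x))"
        using elim \<theta> by (intro add_mono mult_left_mono) auto
      then have "d * (\<sigma>' x - \<sigma> x) \<le> \<xi>' x - g x (\<sigma> x)"
        using elim by (simp add: d_def algebra_simps)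
      then have "\<mu> x * (d * (\<sigma>' x - \<sigma> x)) \<le> \<mu> x * (\<xi>' x - g x (\<sigma> x))"
        using elim by (intro mult_left_mono) (auto simp: \<mu>_def)
      moreover have "w x * (\<sigma>' x - \<sigma> x) = \<mu> x * (d * (\<sigma>' x - \<sigma> x))"
        by (simp add: w_def d_def algebra_simps)
      moreover have "\<eta> x * (\<xi>' x - \<xi> x) = - (\<mu> x * (\<xi>' x - g x (\<sigma> x)))"
        using elim by (auto simp: \<mu>_def algebra_simps)
      ultimately show ?case by linarith
    qed
    then have "(\<integral>x. w x * (\<sigma>' x - \<sigma> x) + \<eta> x * (\<xi>' x - \<xi> x) \<partial>M) \<le> (\<integral>x. 0 \<partial>M)"
      using L2_mult_integrable[OF w L2_diff[OF \<sigma>' \<sigma>]] int[OF \<xi>' \<xi>]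
      by (intro integral_mono_AE) auto
    then show "(\<integral>x. w x * (\<sigma>' x - \<sigma> x) \<partial>M) + (\<integral>x. \<eta> x * (\<xi>' x - \<xi> x) \<partial>M) \<le> 0"
      using L2_mult_integrable[OF w L2_diff[OF \<sigma>' \<sigma>]] int[OF \<xi>' \<xi>] by simp
  qed
qed

section \<open>Inverses of the yield limits\<close>

text \<open>Together with its decreasing counterpart, this turns both yield conditions into lower
  bounds on the internal variable.\<close>

lemma inv_le_iff_of_strict_mono:
  fixes f :: "real \<Rightarrow> real"
  assumes "strict_mono f" "surj f"
  shows "inv f s \<le> z \<longleftrightarrow> s \<le> f z"
  using strict_mono_less_eq[OF assms(1), of "inv f s" z] surj_f_inv_f[OF assms(2), of s] by simp

lemma inv_le_iff_of_strict_antimono: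
  fixes f :: "real \<Rightarrow> real"
  assumes "strict_antimono_on UNIV f" "surj f"
  shows "inv f s \<le> z \<longleftrightarrow> f z \<le> s"
proof -
  have "f y < f x" if "x < y" for x y
    using monotone_onD[OF assms(1)] that by blast
  then have "f z \<le> f (inv f s) \<longleftrightarrow> inv f s \<le> z"
    by (metis linorder_not_less order_le_less)
  then show ?thesis by (simp add: surj_f_inv_f[OF assms(2)])
qed

text \<open>Applying the increasing \<open>f\<close> to the claim leaves the concavity inequality of
  \<open>f\<close> at the preimages.\<close>

lemma convex_on_inv_strict_mono:
  fixes f :: "real \<Rightarrow> real"
  assumes f: "concave_on UNIV f" and mono: "strict_mono f" and surj: "surj f"
  shows "convex_on UNIV (inv f)"
proof (rule convex_onI)
  fix t x y :: real
  assume "0 < t" "t < 1"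
  then have "(1 - t) * f (inv f x) + t * f (inv f y) \<le> f ((1 - t) * inv f x + t * inv f y)"
    using convex_onD[OF f[unfolded concave_on_def], of t "inv f x" "inv f y"] by simp
  then show "inv f ((1 - t) *\<^sub>R x + t *\<^sub>R y) \<le> (1 - t) * inv f x + t * inv f y"
    by (simp add: inv_le_iff_of_strict_mono[OF mono surj] surj_f_inv_f[OF surj])
qed simp

text \<open>A decreasing \<open>f\<close> reverses the inequality, so here it is convexity of
  \<open>f\<close> that makes the inverse convex.\<close>

lemma convex_on_inv_strict_antimono:
  fixes f :: "real \<Rightarrow> real"
  assumes f: "convex_on UNIV f" and mono: "strict_antimono_on UNIV f" and surj: "surj f"
  shows "convex_on UNIV (inv f)"
proof (rule convex_onI)
  fix t x y :: real
  assume "0 < t" "t < 1"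
  then have "f ((1 - t) * inv f x + t * inv f y) \<le> (1 - t) * f (inv f x) + t * f (inv f y)"
    using convex_onD[OF f, of t "inv f x" "inv f y"] by simp
  then show "inv f ((1 - t) *\<^sub>R x + t *\<^sub>R y) \<le> (1 - t) * inv f x + t * inv f y"
    by (simp add: inv_le_iff_of_strict_antimono[OF mono surj] surj_f_inv_f[OF surj])
qed simp

lemma convex_on_max:
  fixes f g :: "real \<Rightarrow> real"
  assumes f: "convex_on UNIV f" and g: "convex_on UNIV g"
  shows "convex_on UNIV (\<lambda>x. max (f x) (g x))"
proof (rule convex_onI)
  fix t x y :: real
  assume t: "0 < t" "t < 1"
  have "f ((1 - t) *\<^sub>R x + t *\<^sub>R y) \<le> (1 - t) * f x + t * f y"
    "g ((1 - t) *\<^sub>R x + t *\<^sub>R y) \<le> (1 - t) * g x + t * g y"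
    using convex_onD[OF f, of t x y] convex_onD[OF g, of t x y] t by simp_all
  moreover have "(1 - t) * f x + t * f y \<le> (1 - t) * max (f x) (g x) + t * max (f y) (g y)"
    "(1 - t) * g x + t * g y \<le> (1 - t) * max (f x) (g x) + t * max (f y) (g y)"
    using t by (intro add_mono mult_left_mono; simp)+
  ultimately show "max (f ((1 - t) *\<^sub>R x + t *\<^sub>R y)) (g ((1 - t) *\<^sub>R x + t *\<^sub>R y))
      \<le> (1 - t) * max (f x) (g x) + t * max (f y) (g y)"
    by (intro max.boundedI) (rule order_trans, assumption, assumption)+
qed simp

section \<open>Multipliers for the two hardening laws\<close>

text \<open>With \<open>sp x\<close> increasing and \<open>sm x\<close> decreasing, the yield set is
  the epigraph of the larger of the two inverses, and \<open>epigraph_multiplier\<close>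
  applies.\<close>

lemma expanding_elastic_range_multiplier:
  assumes fin: "finite_measure M"
    and minus: "AE x in M. convex_on UNIV (sm x) \<and>
           (strict_mono (sm x) \<or> strict_antimono_on UNIV (sm x)) \<and> surj (sm x)"
    and plus: "AE x in M. concave_on UNIV (sp x) \<and>
           (strict_mono (sp x) \<or> strict_antimono_on UNIV (sp x)) \<and> surj (sp x)"
    and expanding: "expanding_elastic_range M sm sp"
    and mem: "(\<sigma>, \<xi>) \<in> yield_set M sm sp" and \<eta>: "\<eta> \<in> L2 M"
    and normal: "\<And>k \<xi>'. (\<lambda>x. \<sigma> x + k, \<xi>') \<in> yield_set M sm sp \<Longrightarrow>
        k * m + (\<integral>x. \<eta> x * (\<xi>' x - \<xi> x) \<partial>M) \<le> 0"
  obtains (multiplier) w where "w \<in> L2 M" "(\<integral>x. w x \<partial>M) = m"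
    "\<And>\<sigma>' \<xi>'. (\<sigma>', \<xi>') \<in> yield_set M sm sp \<Longrightarrow>
       (\<integral>x. w x * (\<sigma>' x - \<sigma> x) \<partial>M) + (\<integral>x. \<eta> x * (\<xi>' x - \<xi> x) \<partial>M) \<le> 0"
proof -
  interpret finite_measure M by (fact fin)
  have mono: "AE x in M. mono (sp x) \<and> antimono (sm x)"
    and [measurable]: "\<And>z. (\<lambda>x. sm x z) \<in> borel_measurable M" "\<And>z. (\<lambda>x. sp x z) \<in> borel_measurable M"
    using expanding by (auto simp: expanding_elastic_range_def)
  obtain \<psi> c where \<psi>: "\<psi> \<in> L2 M" and growth: "AE x in M. \<forall>s.
        max \<bar>inv (sm x) s\<bar> \<bar>inv (sp x) s\<bar> \<le> \<psi> x + c * \<bar>s\<bar>"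
    using expanding by (auto simp: expanding_elastic_range_def)
  have "AE x in M. convex_on UNIV (inv (sm x)) \<and> convex_on UNIV (inv (sp x)) \<and>
      (\<forall>s z. inv (sm x) s \<le> z \<longleftrightarrow> sm x z \<le> s) \<and> (\<forall>s z. inv (sp x) s \<le> z \<longleftrightarrow> s \<le> sp x z) \<and>
      (\<forall>s. max \<bar>inv (sm x) s\<bar> \<bar>inv (sp x) s\<bar> \<le> \<psi> x + c * \<bar>s\<bar>)" (is "AE x in M. ?good x")
    using minus plus mono growth
  proof eventually_elim
    case (elim x)
    \<comment> \<open>The weak monotonicity of known direction rules out one of the two strict
      alternatives, by comparing the values at 0 and 1.\<close>
    have "\<not> strict_mono (sm x)"
      using elim antimonoD[of "sm x" 0 1] strict_monoD[of "sm x" 0 1] by force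
    then have sm: "strict_antimono_on UNIV (sm x)" using elim by blast
    have "\<not> strict_antimono_on UNIV (sp x)"
      using elim monoD[of "sp x" 0 1] monotone_onD[of UNIV _ _ "sp x" 0 1] by force
    then have sp: "strict_mono (sp x)" using elim by blast
    show ?case
      using elim convex_on_inv_strict_antimono[OF _ sm] inv_le_iff_of_strict_antimono[OF sm]
        convex_on_inv_strict_mono[OF _ sp] inv_le_iff_of_strict_mono[OF sp] by simp
  qed
  then obtain N where good: "\<And>x. x \<in> space M - N \<Longrightarrow> ?good x" and N: "N \<in> null_sets M"
    by (rule AE_E3) blast
  have [measurable]: "N \<in> sets M" using N by auto
  \<comment> \<open>On \<open>N\<close> the inverses are uncontrolled; the value 0 there makes
    \<open>g x (f x)\<close> measurable in \<open>x\<close> for every measurable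
    \<open>f\<close>.\<close>
  define g where "g x s = (if x \<in> N then 0 else max (inv (sm x) s) (inv (sp x) s))" for x s
  have notN: "AE x in M. x \<in> space M \<and> x \<notin> N"
    using AE_not_in[OF N] AE_space by eventually_elim simp
  have g_le: "g x s \<le> z \<longleftrightarrow> sm x z \<le> s \<and> s \<le> sp x z" if "x \<in> space M" "x \<notin> N" for x s z
    using good[of x] that by (simp add: g_def)
  have yield_iff: "(f, h) \<in> yield_set M sm sp \<longleftrightarrow> f \<in> L2 M \<and> h \<in> L2 M \<and> (AE x in M. g x (f x) \<le> h x)" for f h
  proof -
    have "AE x in M. (sm x (h x) \<le> f x \<and> f x \<le> sp x (h x)) \<longleftrightarrow> g x (f x) \<le> h x"
      using notN by eventually_elim (simp add: g_le)
    then have "(AE x in M. sm x (h x) \<le> f x \<and> f x \<le> sp x (h x)) \<longleftrightarrow> (AE x in M. g x (f x) \<le> h x)"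
      by (rule eventually_subst)
    then show ?thesis by (simp add: yield_set_def)
  qed
  have memD: "\<sigma> \<in> L2 M" "\<xi> \<in> L2 M" "AE x in M. g x (\<sigma> x) \<le> \<xi> x"
    using mem by (auto simp: yield_iff)
  show ?thesis
  proof (rule epigraph_multiplier[where g = g and c = c and m = m and \<sigma> = \<sigma> and \<xi> = \<xi> and \<eta> = \<eta>])
    show "AE x in M. convex_on UNIV (g x)"
      using notN
    proof eventually_elim
      case (elim x)
      then have "g x = (\<lambda>s. max (inv (sm x) s) (inv (sp x) s))" by (auto simp: g_def)
      then show ?case using good[of x] elim convex_on_max by simp
    qed
    show "AE x in M. \<forall>s. \<bar>g x s\<bar> \<le> \<psi> x + c * \<bar>s\<bar>"
      using notN
    proof eventually_elim
      case (elim x)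
      have "\<bar>g x s\<bar> \<le> max \<bar>inv (sm x) s\<bar> \<bar>inv (sp x) s\<bar>" for s
        using elim by (auto simp: g_def max_def)
      then show ?case using good[of x] elim by (meson DiffI order_trans)
    qed
    show "(\<lambda>x. g x (f x)) \<in> borel_measurable M" if [measurable]: "f \<in> borel_measurable M" for f
    proof (rule borel_measurableI_le)
      fix r
      \<comment> \<open>A sublevel set of the inverses is a condition on the yield limits at the
        fixed internal variable \<open>r\<close>, so measurability of \<open>sm x r\<close> and
        \<open>sp x r\<close> in \<open>x\<close> suffices.\<close>
      have "{x \<in> space M. g x (f x) \<le> r} =
          {x \<in> space M. if x \<in> N then 0 \<le> r else sm x r \<le> f x \<and> f x \<le> sp x r}"
        using g_le by (auto simp: g_def[of _ 0] split: if_splits) (auto simp: g_def)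
      also have "\<dots> \<in> sets M" by measurable
      finally show "{x \<in> space M. g x (f x) \<le> r} \<in> sets M" .
    qed
    show "k * m + (\<integral>x. \<eta> x * (\<xi>' x - \<xi> x) \<partial>M) \<le> 0"
      if "\<xi>' \<in> L2 M" "AE x in M. g x (\<sigma> x + k) \<le> \<xi>' x" for k \<xi>'
      using that L2_add[OF memD(1) L2_const] by (intro normal) (simp add: yield_iff)
    show thesis if "w \<in> L2 M" "(\<integral>x. w x \<partial>M) = m"
      "\<And>\<sigma>' \<xi>'. \<sigma>' \<in> L2 M \<Longrightarrow> \<xi>' \<in> L2 M \<Longrightarrow> AE x in M. g x (\<sigma>' x) \<le> \<xi>' x \<Longrightarrow>
       (\<integral>x. w x * (\<sigma>' x - \<sigma> x) \<partial>M) + (\<integral>x. \<eta> x * (\<xi>' x - \<xi> x) \<partial>M) \<le> 0" for w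
      by (rule multiplier[of w]) (use that in \<open>auto simp: yield_iff\<close>)
  qed (fact fin \<psi> memD \<eta>)+
qed

text \<open>The yield set is a strip invariant under translations by \<open>(H s, s)\<close>. A
  vector \<open>(w, \<eta>)\<close> normal to it is orthogonal to these, which forces
  \<open>w = - \<eta> / H\<close>. Conversely, sliding along the strip reduces an arbitrary
  admissible pair to one with unchanged stress, where \<open>normal\<close> with
  \<open>k = 0\<close> decides.\<close>

lemma linear_kinematic_hardening_multiplier:
  assumes linear: "linear_kinematic_hardening M sm sp"
    and mem: "(\<sigma>, \<xi>) \<in> yield_set M sm sp" and fin: "finite_measure M" and \<eta>: "\<eta> \<in> L2 M"
    and normal: "\<And>k \<xi>'. (\<lambda>x. \<sigma> x + k, \<xi>') \<in> yield_set M sm sp \<Longrightarrow>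
        k * m + (\<integral>x. \<eta> x * (\<xi>' x - \<xi> x) \<partial>M) \<le> 0"
  obtains w where "w \<in> L2 M" "(\<integral>x. w x \<partial>M) = m"
    "\<And>\<sigma>' \<xi>'. (\<sigma>', \<xi>') \<in> yield_set M sm sp \<Longrightarrow>
       (\<integral>x. w x * (\<sigma>' x - \<sigma> x) \<partial>M) + (\<integral>x. \<eta> x * (\<xi>' x - \<xi> x) \<partial>M) \<le> 0"
proof -
  interpret finite_measure M by (fact fin)
  obtain om op H h where "H \<in> Linf M" and h: "h > 0" "AE x in M. h \<le> H x"
    and yield: "AE x in M. \<forall>z. sm x z = om x + H x * z \<and> sp x z = op x + H x * z"
    using linear by (auto simp: linear_kinematic_hardening_def)
  then have [measurable]: "H \<in> borel_measurable M" by (simp add: Linf_def)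
  have bound: "AE x in M. \<bar>1 / H x\<bar> \<le> 1 / h"
    using h(2) by eventually_elim (use h(1) in \<open>auto simp: frac_le\<close>)
  have divH: "(\<lambda>x. f x / H x) \<in> L2 M" if "f \<in> L2 M" for f
    using L2_bounded_mult[OF that _ bound] by simp
  have memD: "\<sigma> \<in> L2 M" "\<xi> \<in> L2 M" "AE x in M. sm x (\<xi> x) \<le> \<sigma> x \<and> \<sigma> x \<le> sp x (\<xi> x)"
    using mem by (auto simp: yield_set_def)
  define w where "w x = - (\<eta> x / H x)" for x
  have w: "w \<in> L2 M" unfolding w_def using L2_uminus[OF divH[OF \<eta>]] .
  have "k * m - k * (\<integral>x. w x \<partial>M) \<le> 0" for k
  proof -
    \<comment> \<open>The translate by \<open>(k, k / H)\<close> runs along the strip, so it is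
      admissible for \<open>k\<close> of either sign; the choices 1 and -1 then give the equality
      for \<open>m\<close>.\<close>
    have "(\<lambda>x. \<xi> x + k / H x) \<in> L2 M" "(\<lambda>x. \<sigma> x + k) \<in> L2 M"
      using L2_add[OF memD(2) divH[OF L2_const]] L2_add[OF memD(1) L2_const] .
    moreover have "AE x in M. sm x (\<xi> x + k / H x) \<le> \<sigma> x + k \<and> \<sigma> x + k \<le> sp x (\<xi> x + k / H x)"
      using memD(3) yield h(2)
      by eventually_elim (use h(1) in \<open>simp add: distrib_left\<close>)
    ultimately have "k * m + (\<integral>x. \<eta> x * ((\<xi> x + k / H x) - \<xi> x) \<partial>M) \<le> 0"
      by (intro normal) (simp add: yield_set_def)
    moreover have "\<eta> x * ((\<xi> x + k / H x) - \<xi> x) = - k * w x" for x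
      by (simp add: w_def)
    ultimately show ?thesis by (simp del: add_diff_cancel_left')
  qed
  from this[of 1] this[of "-1"] have int: "(\<integral>x. w x \<partial>M) = m" by simp
  show ?thesis
  proof (rule that[OF w int])
    fix \<sigma>' \<xi>' assume mem': "(\<sigma>', \<xi>') \<in> yield_set M sm sp"
    then have memD': "\<sigma>' \<in> L2 M" "\<xi>' \<in> L2 M" "AE x in M. sm x (\<xi>' x) \<le> \<sigma>' x \<and> \<sigma>' x \<le> sp x (\<xi>' x)"
      by (auto simp: yield_set_def)
    \<comment> \<open>slide along the direction \<open>(H, 1)\<close> of the strip until the stress is \<open>\<sigma>\<close>\<close>
    define \<zeta> where "\<zeta> x = \<xi>' x - (\<sigma>' x - \<sigma> x) / H x" for x
    have "\<zeta> \<in> L2 M"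
      unfolding \<zeta>_def by (rule L2_diff[OF memD'(2) divH[OF L2_diff[OF memD'(1) memD(1)]]])
    moreover have "AE x in M. sm x (\<zeta> x) \<le> \<sigma> x \<and> \<sigma> x \<le> sp x (\<zeta> x)"
      using memD'(3) yield h(2)
    proof eventually_elim
      case (elim x)
      have "H x * \<zeta> x = H x * \<xi>' x - (\<sigma>' x - \<sigma> x)"
        using elim h(1) by (simp add: \<zeta>_def field_simps)
      then show ?case using elim by simp
    qed
    ultimately have "(\<integral>x. \<eta> x * (\<zeta> x - \<xi> x) \<partial>M) \<le> 0"
      using normal[of 0 \<zeta>] memD(1) by (simp add: yield_set_def)
    moreover have "\<eta> x * (\<zeta> x - \<xi> x) = w x * (\<sigma>' x - \<sigma> x) + \<eta> x * (\<xi>' x - \<xi> x)" for x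
      by (simp add: \<zeta>_def w_def algebra_simps)
    ultimately show "(\<integral>x. w x * (\<sigma>' x - \<sigma> x) \<partial>M) + (\<integral>x. \<eta> x * (\<xi>' x - \<xi> x) \<partial>M) \<le> 0"
      using L2_mult_integrable[OF w L2_diff[OF memD'(1) memD(1)]]
        L2_mult_integrable[OF \<eta> L2_diff[OF memD'(2) memD(2)]] by simp
  qed
qed

section \<open>From the multiplier to an element of the strain rate set\<close>

lemma LinfD:
  assumes "f \<in> Linf M"
  obtains K where "f \<in> borel_measurable M" "AE x in M. \<bar>f x\<bar> \<le> K"
  using assms by (auto simp: Linf_def)

lemma AE_inverse_bound:
  fixes C :: "'x \<Rightarrow> real"
  assumes "AE x in M. c0 \<le> C x" "c0 > 0"
  shows "AE x in M. \<bar>1 / C x\<bar> \<le> 1 / c0"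
  using assms(1) by eventually_elim (use assms(2) in \<open>auto simp: frac_le\<close>)

text \<open>
  A multiplier \<open>w\<close> of the constraint that stresses are constant gives the element \<open>(C w, -d\<xi>)\<close> of
  the normal cone and hence the stress increment \<open>C w + dy\<close>, whose strain has mean zero.
\<close>

lemma strain_rate_set_nonempty:
  fixes M :: "'x measure" and C :: "'x \<Rightarrow> real" and sm sp :: "'x \<Rightarrow> real \<Rightarrow> real"
  defines "S \<equiv> yield_set M sm sp"
  assumes fin: "finite_measure M" and C: "C \<in> Linf M" and c0: "c0 > 0" "AE x in M. c0 \<le> C x"
    and minus: "AE x in M. convex_on UNIV (sm x) \<and>
           (strict_mono (sm x) \<or> strict_antimono_on UNIV (sm x)) \<and> surj (sm x)"
    and plus: "AE x in M. concave_on UNIV (sp x) \<and>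
           (strict_mono (sp x) \<or> strict_antimono_on UNIV (sp x)) \<and> surj (sp x)"
    and hardening: "expanding_elastic_range M sm sp \<or> linear_kinematic_hardening M sm sp"
    and dy: "has_L2_derivative M C I y dy t" and d\<xi>: "has_L2_derivative M (\<lambda>_. 1) I \<xi> d\<xi> t"
    and d\<tau>: "has_L2_derivative M (\<lambda>_. 1) I \<tau> d\<tau> t"
    and normal: "- (dy, d\<xi>) \<in> normal_cone M C (moving_set M S \<tau> t) (y t, \<xi> t)"
  shows "strain_rate_set M C I S \<tau> y \<xi> t \<noteq> {}"
proof -
  interpret finite_measure M by (fact fin)
  obtain K where [measurable]: "C \<in> borel_measurable M" and K: "AE x in M. \<bar>C x\<bar> \<le> K"
    using C by (rule LinfD)
  have divC: "(\<lambda>x. f x / C x) \<in> L2 M" if "f \<in> L2 M" for f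
    using L2_bounded_mult[OF that _ AE_inverse_bound[OF c0(2,1)]] by simp
  have dy_L2: "dy \<in> L2 M" and d\<xi>_L2: "d\<xi> \<in> L2 M"
    using dy d\<xi> by (auto simp: has_L2_derivative_def)
  define \<sigma> where "\<sigma> = (\<lambda>x. y t x + \<tau> t x)"
  define \<eta> where "\<eta> = (\<lambda>x. - d\<xi> x)"
  \<comment> \<open>\<open>m\<close> is the total strain that the multiplier must supply to cancel
    that of \<open>dy\<close>.\<close>
  define m where "m = - (\<integral>x. dy x / C x \<partial>M)"
  have \<eta>: "\<eta> \<in> L2 M" unfolding \<eta>_def using L2_uminus[OF d\<xi>_L2] .
  have mem: "(y t, \<xi> t) \<in> moving_set M S \<tau> t"
    using normal by (simp add: normal_cone_def)
  have shift_iff: "(f, h) \<in> shift_stress S \<rho> \<longleftrightarrow> ((\<lambda>x. f x + \<rho> x), h) \<in> S" for f h \<rho>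
  proof
    assume "(f, h) \<in> shift_stress S \<rho>"
    then obtain f' where f': "(f', h) \<in> S" "f = f' - \<rho>"
      by (auto simp: shift_stress_def)
    then have "(\<lambda>x. f x + \<rho> x) = f'" by auto
    then show "((\<lambda>x. f x + \<rho> x), h) \<in> S" using f' by simp
  next
    assume *: "((\<lambda>x. f x + \<rho> x), h) \<in> S"
    have "(f, h) = (\<lambda>p. p - (\<rho>, 0)) ((\<lambda>x. f x + \<rho> x), h)"
      by (simp add: fun_eq_iff)
    with * show "(f, h) \<in> shift_stress S \<rho>"
      unfolding shift_stress_def by (rule rev_image_eqI)
  qed
  have \<sigma>S: "(\<sigma>, \<xi> t) \<in> S" and yV: "y t \<in> ae_constants M"
    using mem by (auto simp: moving_set_def shift_iff \<sigma>_def)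
  have y_L2: "y t \<in> L2 M" and \<sigma>_L2: "\<sigma> \<in> L2 M" and \<xi>_L2: "\<xi> t \<in> L2 M"
    using \<sigma>S yV by (auto simp: S_def yield_set_def ae_constants_def)
  \<comment> \<open>Since \<open>y t\<close> is constant, adding \<open>k\<close> keeps it in the
    space of constants, so the sweeping inclusion can be tested there; its stress term equals
    \<open>k * m\<close>.\<close>
  have le: "k * m + (\<integral>x. \<eta> x * (\<xi>' x - \<xi> t x) \<partial>M) \<le> 0"
    if "((\<lambda>x. \<sigma> x + k), \<xi>') \<in> S" for k \<xi>'
  proof -
    obtain k0 where "AE x in M. y t x = k0" using yV by (auto simp: ae_constants_def)
    then have "AE x in M. y t x + k = k0 + k" by eventually_elim simp
    moreover have "(\<lambda>x. y t x + k) \<in> L2 M" using L2_add[OF y_L2 L2_const] .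
    ultimately have "(\<lambda>x. y t x + k) \<in> ae_constants M"
      unfolding ae_constants_def by blast
    moreover have "((\<lambda>x. y t x + k), \<xi>') \<in> shift_stress S (\<tau> t)"
      using that by (simp add: shift_iff \<sigma>_def algebra_simps)
    moreover have "\<xi>' \<in> L2 M" using that by (simp add: S_def yield_set_def)
    ultimately have "((\<lambda>x. y t x + k), \<xi>') \<in> moving_set M S \<tau> t"
      by (simp add: moving_set_def)
    then have "prod_inner M C (- (dy, d\<xi>)) (((\<lambda>x. y t x + k), \<xi>') - (y t, \<xi> t)) \<le> 0"
      using normal unfolding normal_cone_def by blast
    then have "(\<integral>x. - dy x * k / C x \<partial>M) + (\<integral>x. \<eta> x * (\<xi>' x - \<xi> t x) \<partial>M) \<le> 0"
      by (simp add: prod_inner_def L2_inner_def \<eta>_def)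
    moreover have "(\<integral>x. - dy x * k / C x \<partial>M) = (\<integral>x. - k * (dy x / C x) \<partial>M)"
      by (intro Bochner_Integration.integral_cong) auto
    ultimately show ?thesis unfolding integral_mult_right_zero by (simp add: m_def)
  qed
  obtain w where w: "w \<in> L2 M" "(\<integral>x. w x \<partial>M) = m"
    and w_normal: "\<And>\<sigma>' \<xi>'. (\<sigma>', \<xi>') \<in> S \<Longrightarrow>
       (\<integral>x. w x * (\<sigma>' x - \<sigma> x) \<partial>M) + (\<integral>x. \<eta> x * (\<xi>' x - \<xi> t x) \<partial>M) \<le> 0"
    using hardening
  proof
    assume "expanding_elastic_range M sm sp"
    from expanding_elastic_range_multiplier[OF fin minus plus this \<sigma>S[unfolded S_def] \<eta> le[unfolded S_def]]
    show thesis using that unfolding S_def by blast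
  next
    assume "linear_kinematic_hardening M sm sp"
    from linear_kinematic_hardening_multiplier[OF this \<sigma>S[unfolded S_def] fin \<eta> le[unfolded S_def]]
    show thesis using that unfolding S_def by blast
  qed
  \<comment> \<open>The inner product on stresses has weight \<open>1 / C\<close>, so
    \<open>C * w\<close> represents the functional that \<open>w\<close> defines without
    weight.\<close>
  define z where "z = (\<lambda>x. C x * w x)"
  have z: "z \<in> L2 M" unfolding z_def using L2_bounded_mult[OF w(1) _ K] by simp
  note [measurable] = L2_measurable[OF w(1)] L2_measurable[OF \<sigma>_L2] L2_measurable[OF y_L2]
    L2_measurable[OF dy_L2] L2_measurable[OF z]
  have C_nz: "AE x in M. C x \<noteq> 0"
    using c0(2) by eventually_elim (use c0(1) in auto)
  have "prod_inner M C (z, \<eta>) (p - (y t, \<xi> t)) \<le> 0" if "p \<in> shift_stress S (\<tau> t)" for p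
  proof -
    obtain f h where p: "p = (f, h)" by (cases p)
    have fS: "((\<lambda>x. f x + \<tau> t x), h) \<in> S" using that by (simp add: p shift_iff)
    then have "(\<lambda>x. (f x + \<tau> t x) - \<sigma> x) \<in> L2 M"
      by (intro L2_diff \<sigma>_L2) (simp add: S_def yield_set_def)
    then have [measurable]: "(\<lambda>x. f x - y t x) \<in> borel_measurable M"
      by (simp add: \<sigma>_def L2_def)
    have "(\<integral>x. z x * (f x - y t x) / C x \<partial>M) = (\<integral>x. w x * ((f x + \<tau> t x) - \<sigma> x) \<partial>M)"
    proof (rule integral_cong_AE)
      show "AE x in M. z x * (f x - y t x) / C x = w x * ((f x + \<tau> t x) - \<sigma> x)"
        using C_nz by eventually_elim (simp add: z_def \<sigma>_def)
      show "(\<lambda>x. w x * ((f x + \<tau> t x) - \<sigma> x)) \<in> borel_measurable M"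
        unfolding \<sigma>_def by simp
    qed measurable
    then show ?thesis
      using w_normal[OF fS] by (simp add: p prod_inner_def L2_inner_def)
  qed
  moreover have "(y t, \<xi> t) \<in> shift_stress S (\<tau> t)"
    using mem by (simp add: moving_set_def)
  ultimately have cone: "(z, \<eta>) \<in> normal_cone M C (shift_stress S (\<tau> t)) (y t, \<xi> t)"
    using z \<eta> by (simp add: normal_cone_def)
  have "(\<integral>x. (z x + dy x) / C x \<partial>M) = (\<integral>x. w x + dy x / C x \<partial>M)"
    by (rule integral_cong_AE, measurable) (use C_nz in \<open>eventually_elim, simp add: z_def add_divide_distrib\<close>)
  also have "\<dots> = 0"
    using L2_integrable[OF w(1)] L2_integrable[OF divC[OF dy_L2]] by (simp add: w(2) m_def)
  finally have U: "z + dy \<in> zero_mean_strains M C"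
    using L2_add[OF z dy_L2] by (simp add: zero_mean_strains_def plus_fun_def)
  have "\<eta> + d\<xi> = (\<lambda>_. 0)" by (simp add: \<eta>_def fun_eq_iff)
  then have "\<eta> + d\<xi> \<in> ae_zero M"
    using L2_const[of 0] by (simp add: ae_zero_def)
  with cone U have "(z, \<eta>) + (dy, d\<xi>) \<in> (\<lambda>z. z + (dy, d\<xi>)) ` normal_cone M C (shift_stress S (\<tau> t)) (y t, \<xi> t)
      \<inter> (zero_mean_strains M C \<times> ae_zero M)"
    by (intro IntI imageI) simp_all
  then have "(\<lambda>\<sigma> x. (\<sigma> x + d\<tau> x) / C x) (fst ((z, \<eta>) + (dy, d\<xi>))) \<in> strain_rate_set M C I S \<tau> y \<xi> t"
    unfolding strain_rate_set_def
    by (intro CollectI exI[of _ dy] exI[of _ d\<xi>] exI[of _ d\<tau>] conjI imageI dy d\<xi> d\<tau>)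
  then show ?thesis by blast
qed

section \<open>Time derivative of the elastic stress solution\<close>

lemma L2_norm_le_of_bounded:
  assumes fin: "finite_measure M" and le: "AE x in M. \<bar>f x\<bar> \<le> K" and K: "K \<ge> 0"
  shows "L2_norm M (\<lambda>_. 1) f \<le> K * sqrt (measure M (space M))"
proof -
  interpret finite_measure M by (fact fin)
  have "(\<integral>x. f x * f x / 1 \<partial>M) \<le> (\<integral>x. K\<^sup>2 \<partial>M)"
  proof (rule integral_mono_AE')
    show "AE x in M. f x * f x / 1 \<le> K\<^sup>2"
      using le
    proof eventually_elim
      case (elim x)
      then have "(f x)\<^sup>2 \<le> K\<^sup>2" using abs_le_square_iff[of "f x" K] K by simp
      then show ?case by (simp add: power2_eq_square)
    qed
  qed auto
  also have "\<dots> = measure M (space M) * K\<^sup>2" by simp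
  finally have "L2_norm M (\<lambda>_. 1) f \<le> sqrt (measure M (space M) * K\<^sup>2)"
    unfolding L2_norm_def L2_inner_def by (rule real_sqrt_le_mono)
  then show ?thesis using K by (simp add: real_sqrt_mult mult.commute)
qed

lemma W1inf_AE_derivative:
  assumes "u \<in> W1inf I"
  shows "AE t in lebesgue_on I. \<exists>v. ((\<lambda>s. (u s - u t) / (s - t) - v) \<longlongrightarrow> 0) (at t within I)"
proof -
  obtain v where "AE t in lebesgue_on I. (u has_real_derivative v t) (at t within I)"
    using assms by (auto simp: W1inf_def)
  then show ?thesis
  proof eventually_elim
    case (elim t)
    then show ?case
      unfolding has_field_derivative_iff by (intro exI[of _ "v t"]) (rule LIM_zero)
  qed
qed

context
  fixes a b :: real and M :: "real measure" and C :: "real \<Rightarrow> real" and c0 :: real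
  defines "M \<equiv> lebesgue_on {a<..<b}"
  assumes ab: "a < b" and C: "C \<in> Linf M" and c0: "c0 > 0" "AE x in M. c0 \<le> C x"
begin

lemma interval_measure: "finite_measure M" "measure M (space M) = b - a" "space M = {a<..<b}"
proof -
  show "finite_measure M" unfolding M_def
    by (intro finite_measure_lebesgue_on) simp
  show "space M = {a<..<b}" by (simp add: M_def)
  then show "measure M (space M) = b - a"
    using ab by (simp add: M_def measure_restrict_space)
qed

lemma set_integral_interval: "(LINT y:{a<..<b}|lebesgue. f y) = (\<integral>y. f y \<partial>M)"
  for f :: "real \<Rightarrow> real"
  by (simp add: M_def set_lebesgue_integral_def integral_restrict_space)

text \<open>Moving the variable upper limit into the integrand leaves an integral over the fixed
  measure \<open>M\<close>, from which linearity, bounds and measurability in \<open>x\<close>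
  follow.\<close>

lemma primitive_eq:
  fixes f :: "real \<Rightarrow> real"
  assumes "x \<in> {a<..<b}"
  shows "(LINT y:{a<..<x}|lebesgue. f y) = (\<integral>y. (if y < x then f y else 0) \<partial>M)"
proof -
  have "indicator {a<..<x} y *\<^sub>R f y = indicator {a<..<b} y *\<^sub>R (if y < x then f y else 0)" for y
    using assms by (auto simp: indicator_def)
  then show ?thesis
    by (simp add: M_def set_lebesgue_integral_def integral_restrict_space)
qed

text \<open>The bound, uniform in \<open>x\<close>, is Cauchy-Schwarz on the whole interval; bounded
  measurable functions are square integrable on a finite measure space.\<close>

lemma primitive_L2:
  assumes f: "f \<in> L2 M"
  shows "x \<in> {a<..<b} \<Longrightarrow>
      \<bar>LINT y:{a<..<x}|lebesgue. f y\<bar> \<le> sqrt (b - a) * L2_norm M (\<lambda>_. 1) f"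
    and "(\<lambda>x. LINT y:{a<..<x}|lebesgue. f y) \<in> L2 M"
proof -
  interpret finite_measure M by (fact interval_measure)
  note [measurable] = L2_measurable[OF f]
  have id[measurable]: "(\<lambda>x. x) \<in> borel_measurable M"
    unfolding M_def by (intro measurable_restrict_space1 measurable_completion) simp
  show bound: "\<bar>LINT y:{a<..<x}|lebesgue. f y\<bar> \<le> sqrt (b - a) * L2_norm M (\<lambda>_. 1) f"
    if "x \<in> {a<..<b}" for x
  proof -
    have "\<bar>\<integral>y. (if y < x then f y else 0) \<partial>M\<bar> \<le> (\<integral>y. \<bar>if y < x then f y else 0\<bar> \<partial>M)"
      by (rule integral_abs_bound)
    also have "\<dots> \<le> (\<integral>y. \<bar>f y\<bar> \<partial>M)"
      by (rule integral_mono') (use L2_integrable[OF f] in auto)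
    also have "\<dots> \<le> sqrt (b - a) * L2_norm M (\<lambda>_. 1) f"
      using integral_abs_le_L2_norm[OF f] unfolding interval_measure(2) .
    finally show ?thesis by (simp only: primitive_eq[OF that])
  qed
  \<comment> \<open>Comparing the two coordinates makes the integrand jointly measurable on the
    product, whence its integral is measurable in \<open>x\<close>.\<close>
  have [measurable]: "(\<lambda>p. fst p :: real) \<in> borel_measurable (M \<Otimes>\<^sub>M M)"
    "(\<lambda>p. snd p :: real) \<in> borel_measurable (M \<Otimes>\<^sub>M M)"
    using measurable_compose[OF measurable_fst id] measurable_compose[OF measurable_snd id] .
  have "(\<lambda>x. \<integral>y. (if y < x then f y else 0) \<partial>M) \<in> borel_measurable M"
    by (rule borel_measurable_lebesgue_integral) (simp add: case_prod_beta', measurable)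
  then have meas: "(\<lambda>x. LINT y:{a<..<x}|lebesgue. f y) \<in> borel_measurable M"
    by (rule measurable_cong[THEN iffD2, rotated]) (use primitive_eq interval_measure in auto)
  show "(\<lambda>x. LINT y:{a<..<x}|lebesgue. f y) \<in> L2 M"
    using meas AE_I2[OF bound] by (rule L2_of_bounded) (simp add: interval_measure)
qed

text \<open>Linearity of the primitive, in the shape of the remainder of a difference quotient with
  step \<open>d\<close>. The case \<open>d = 0\<close> is included, as quotients by 0 are 0.\<close>

lemma primitive_difference_quotient:
  assumes f: "f \<in> L2 M" and g: "g \<in> L2 M" and h: "h \<in> L2 M" and x: "x \<in> {a<..<b}"
  shows "(LINT y:{a<..<x}|lebesgue. (f y - g y) / d - h y) =
     ((LINT y:{a<..<x}|lebesgue. f y) - (LINT y:{a<..<x}|lebesgue. g y)) / d - (LINT y:{a<..<x}|lebesgue. h y)"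
proof -
  interpret finite_measure M by (fact interval_measure)
  have [measurable]: "(\<lambda>x. x) \<in> borel_measurable M"
    unfolding M_def by (intro measurable_restrict_space1 measurable_completion) simp
  have int: "integrable M (\<lambda>y. if y < x then u y else 0)" if "u \<in> L2 M" for u
    by (rule Bochner_Integration.integrable_bound[OF L2_integrable[OF that]])
      (use L2_measurable[OF that] in auto)
  have "(\<integral>y. (if y < x then (f y - g y) / d - h y else 0) \<partial>M) =
    (\<integral>y. ((if y < x then f y else 0) - (if y < x then g y else 0)) / d - (if y < x then h y else 0) \<partial>M)"
    by (intro Bochner_Integration.integral_cong) auto
  then show ?thesis
    using int[OF f] int[OF g] int[OF h] by (simp add: primitive_eq[OF x])
qed

text \<open>\<open>K\<close> is the load term of the elastic stress. Its boundedness combines the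
  uniform bound on primitives with the bound \<open>1 / c0\<close> on \<open>1 / C\<close>.\<close>

lemma weighted_primitive_difference_quotient:
  fixes K :: "(real \<Rightarrow> real) \<Rightarrow> real"
  defines "K \<equiv> (\<lambda>f. LINT z:{a<..<b}|lebesgue. 1 / C z * (LINT y:{a<..<z}|lebesgue. f y))"
  assumes f: "f \<in> L2 M" and g: "g \<in> L2 M" and h: "h \<in> L2 M"
  shows "K (\<lambda>y. (f y - g y) / d - h y) = (K f - K g) / d - K h"
    and "\<bar>K f\<bar> \<le> (b - a) / c0 * (sqrt (b - a) * L2_norm M (\<lambda>_. 1) f)"
proof -
  interpret finite_measure M by (fact interval_measure)
  have [measurable]: "C \<in> borel_measurable M" using C by (simp add: Linf_def)
  note inverse_bound = AE_inverse_bound[OF c0(2,1)]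
  define J where "J = (\<lambda>(f :: real \<Rightarrow> real) x. LINT y:{a<..<x}|lebesgue. f y)"
  have K: "K u = (\<integral>z. 1 / C z * J u z \<partial>M)" for u
    by (simp add: K_def J_def set_integral_interval)
  have J: "J u \<in> L2 M" if "u \<in> L2 M" for u
    using primitive_L2(2)[OF that] by (simp add: J_def)
  have int: "integrable M (\<lambda>z. 1 / C z * J u z)" if "u \<in> L2 M" for u
    using L2_integrable[OF L2_bounded_mult[OF J[OF that] _ inverse_bound]] by simp
  have "K (\<lambda>y. (f y - g y) / d - h y) = (\<integral>z. (1 / C z * J f z - 1 / C z * J g z) / d - 1 / C z * J h z \<partial>M)"
    unfolding K
  proof (rule Bochner_Integration.integral_cong[OF refl])
    fix z assume "z \<in> space M"
    then have "J (\<lambda>y. (f y - g y) / d - h y) z = (J f z - J g z) / d - J h z"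
      unfolding J_def by (intro primitive_difference_quotient[OF f g h]) (simp add: interval_measure)
    then show "1 / C z * J (\<lambda>y. (f y - g y) / d - h y) z =
        (1 / C z * J f z - 1 / C z * J g z) / d - 1 / C z * J h z"
      by (simp add: right_diff_distrib diff_divide_distrib)
  qed
  also have "\<dots> = (K f - K g) / d - K h"
    unfolding K using int[OF f] int[OF g] int[OF h] by simp
  finally show "K (\<lambda>y. (f y - g y) / d - h y) = (K f - K g) / d - K h" .
  define B where "B = sqrt (b - a) * L2_norm M (\<lambda>_. 1) f"
  have "\<bar>K f\<bar> \<le> (\<integral>z. \<bar>1 / C z * J f z\<bar> \<partial>M)"
    unfolding K by (rule integral_abs_bound)
  also have "\<dots> \<le> (\<integral>z. 1 / c0 * B \<partial>M)"
  proof (rule integral_mono_AE)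
    show "AE z in M. \<bar>1 / C z * J f z\<bar> \<le> 1 / c0 * B"
      using inverse_bound AE_space
    proof eventually_elim
      case (elim z)
      then have "\<bar>J f z\<bar> \<le> B"
        using primitive_L2(1)[OF f, of z] by (simp add: J_def B_def interval_measure)
      then show ?case unfolding abs_mult using elim c0(1) by (intro mult_mono) auto
    qed
    show "integrable M (\<lambda>z. \<bar>1 / C z * J f z\<bar>)"
      using int[OF f] by (rule integrable_abs)
  qed simp
  also have "\<dots> = (b - a) / c0 * B"
    using interval_measure by simp
  finally show "\<bar>K f\<bar> \<le> (b - a) / c0 * (sqrt (b - a) * L2_norm M (\<lambda>_. 1) f)"
    by (simp add: B_def)
qed

text \<open>The elastic stress is linear in \<open>(ua, ub, F)\<close>, so the remainder of its
  difference quotient is the same expression in the remainders of the data, and it is small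
  uniformly in \<open>x\<close>. The derivative is the stress formula with the rates
  \<open>va\<close>, \<open>vb\<close>, \<open>G\<close> as data constant in time.\<close>

lemma stress_solution_L2_derivative:
  assumes F: "\<And>s. s \<in> I \<Longrightarrow> F s \<in> L2 M" and t: "t \<in> I"
    and ua: "((\<lambda>s. (ua s - ua t) / (s - t) - va) \<longlongrightarrow> 0) (at t within I)"
    and ub: "((\<lambda>s. (ub s - ub t) / (s - t) - vb) \<longlongrightarrow> 0) (at t within I)"
    and G: "has_L2_derivative M (\<lambda>_. 1) I F G t"
  shows "has_L2_derivative M (\<lambda>_. 1) I (stress_solution a b C ua ub F)
      (stress_solution a b C (\<lambda>_. va) (\<lambda>_. vb) (\<lambda>_. G) t) t"
proof -
  interpret finite_measure M by (fact interval_measure)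
  define J where "J = (\<lambda>(f::real \<Rightarrow> real) x. LINT y:{a<..<x}|lebesgue. f y)"
  define K where "K = (\<lambda>(f::real \<Rightarrow> real). LINT z:{a<..<b}|lebesgue. 1 / C z * (LINT y:{a<..<z}|lebesgue. f y))"
  define \<omega> where "\<omega> = inverse (LINT y:{a<..<b}|lebesgue. 1 / C y)"
  define B where "B = sqrt (b - a)"
  define r where "r = (\<lambda>s. L2_norm M (\<lambda>_. 1) (\<lambda>x. (F s x - F t x) / (s - t) - G x))"
  define e where "e = (\<lambda>s. ((ub s - ub t) / (s - t) - vb) - ((ua s - ua t) / (s - t) - va))"
  \<comment> \<open>\<open>\<epsilon>\<close> collects the data remainders: \<open>e\<close> from
    the end displacements, and \<open>r\<close> from the load, once through \<open>K\<close> and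
    once through the primitive.\<close>
  define \<epsilon> where "\<epsilon> = (\<lambda>s. \<bar>\<omega>\<bar> * (\<bar>e s\<bar> + (b - a) / c0 * (B * r s)) + B * r s)"
  define \<tau> where "\<tau> = stress_solution a b C ua ub F"
  define d\<tau> where "d\<tau> = stress_solution a b C (\<lambda>_. va) (\<lambda>_. vb) (\<lambda>_. G) t"
  have G_L2: "G \<in> L2 M" and r: "(r \<longlongrightarrow> 0) (at t within I)"
    using G by (auto simp: has_L2_derivative_def r_def)
  have \<tau>: "\<tau> s x = \<omega> * (ub s - ua s + K (F s)) - J (F s) x" for s x
    by (simp add: \<tau>_def stress_solution_def \<omega>_def K_def J_def)
  have d\<tau>: "d\<tau> x = \<omega> * (vb - va + K G) - J G x" for x
    by (simp add: d\<tau>_def stress_solution_def \<omega>_def K_def J_def)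
  have "d\<tau> = (\<lambda>x. \<omega> * (vb - va + K G) - J G x)"
    by (simp add: d\<tau> fun_eq_iff)
  then have d\<tau>_L2: "d\<tau> \<in> L2 M"
    using L2_diff[OF L2_const primitive_L2(2)[OF G_L2]] by (simp add: J_def)
  have r0: "r s \<ge> 0" for s
    by (simp add: r_def L2_norm_def L2_inner_def)
  have B: "B \<ge> 0" using ab by (simp add: B_def)
  have \<epsilon>0: "\<epsilon> s \<ge> 0" for s
    using r0[of s] B ab c0(1) by (simp add: \<epsilon>_def)
  have pointwise: "\<bar>(\<tau> s x - \<tau> t x) / (s - t) - d\<tau> x\<bar> \<le> \<epsilon> s" if s: "s \<in> I" and x: "x \<in> {a<..<b}" for s x
  proof -
    define R where "R = (\<lambda>y. (F s y - F t y) / (s - t) - G y)"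
    have "(\<lambda>y. inverse (s - t) * (F s y - F t y) - G y) \<in> L2 M"
      by (intro L2_diff L2_scale F s t G_L2)
    then have R_L2: "R \<in> L2 M" by (simp add: R_def divide_inverse mult.commute)
    have KR: "K R = (K (F s) - K (F t)) / (s - t) - K G"
      unfolding R_def K_def by (rule weighted_primitive_difference_quotient(1)[OF F[OF s] F[OF t] G_L2])
    have JR: "J R x = (J (F s) x - J (F t) x) / (s - t) - J G x"
      unfolding R_def J_def by (rule primitive_difference_quotient[OF F[OF s] F[OF t] G_L2 x])
    have Kb: "\<bar>K R\<bar> \<le> (b - a) / c0 * (B * r s)"
      using weighted_primitive_difference_quotient(2)[OF R_L2 R_L2 R_L2]
      by (simp add: K_def B_def r_def R_def)
    have Jb: "\<bar>J R x\<bar> \<le> B * r s"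
      using primitive_L2(1)[OF R_L2 x] by (simp add: J_def B_def r_def R_def)
    have "(\<tau> s x - \<tau> t x) / (s - t) - d\<tau> x = \<omega> * (e s + K R) - J R x"
      unfolding \<tau> d\<tau> KR JR e_def by (simp add: diff_divide_distrib add_divide_distrib algebra_simps)
    also have "\<bar>\<dots>\<bar> \<le> \<bar>\<omega>\<bar> * (\<bar>e s\<bar> + \<bar>K R\<bar>) + \<bar>J R x\<bar>"
      using abs_triangle_ineq4[of "\<omega> * (e s + K R)" "J R x"]
        mult_left_mono[OF abs_triangle_ineq[of "e s" "K R"], of "\<bar>\<omega>\<bar>"] by (simp add: abs_mult)
    also have "\<dots> \<le> \<epsilon> s"
      unfolding \<epsilon>_def using Kb Jb by (intro add_mono mult_left_mono) auto
    finally show ?thesis .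
  qed
  have "(e \<longlongrightarrow> 0 - 0) (at t within I)"
    unfolding e_def by (intro tendsto_diff ua ub)
  then have "((\<lambda>s. \<bar>e s\<bar>) \<longlongrightarrow> 0) (at t within I)"
    by (intro tendsto_rabs_zero) simp
  then have "((\<lambda>s. \<epsilon> s * B) \<longlongrightarrow> (\<bar>\<omega>\<bar> * (0 + (b - a) / c0 * (B * 0)) + B * 0) * B) (at t within I)"
    unfolding \<epsilon>_def by (intro tendsto_mult tendsto_add tendsto_const r)
  then have lim: "((\<lambda>s. \<epsilon> s * B) \<longlongrightarrow> 0) (at t within I)" by simp
  have "((\<lambda>s. L2_norm M (\<lambda>_. 1) (\<lambda>x. (\<tau> s x - \<tau> t x) / (s - t) - d\<tau> x)) \<longlongrightarrow> 0) (at t within I)"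
  proof (rule tendsto_sandwich[OF _ _ tendsto_const lim])
    show "\<forall>\<^sub>F s in at t within I. 0 \<le> L2_norm M (\<lambda>_. 1) (\<lambda>x. (\<tau> s x - \<tau> t x) / (s - t) - d\<tau> x)"
      by (simp add: L2_norm_def L2_inner_def)
    \<comment> \<open>Passing from the uniform bound to the norm costs the factor \<open>B\<close>,
      the square root of the interval length.\<close>
    have "L2_norm M (\<lambda>_. 1) (\<lambda>x. (\<tau> s x - \<tau> t x) / (s - t) - d\<tau> x) \<le> \<epsilon> s * B" if "s \<in> I" for s
      unfolding B_def interval_measure(2)[symmetric]
      by (rule L2_norm_le_of_bounded[OF interval_measure(1) _ \<epsilon>0], rule AE_I2)
        (use pointwise[OF that] interval_measure(3) in auto)
    then show "\<forall>\<^sub>F s in at t within I. L2_norm M (\<lambda>_. 1) (\<lambda>x. (\<tau> s x - \<tau> t x) / (s - t) - d\<tau> x) \<le> \<epsilon> s * B"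
      by (simp add: eventually_at_filter)
  qed
  then show ?thesis
    using d\<tau>_L2 by (simp add: has_L2_derivative_def \<tau>_def d\<tau>_def)
qed

end

section \<open>Nonemptiness at almost every time\<close>

theorem corollary6p1:
  fixes a b T c0 C0 :: real
    and C :: "real \<Rightarrow> real"
    and ua ub :: "real \<Rightarrow> real"
    and F :: "real \<Rightarrow> real \<Rightarrow> real"
    and \<sigma>m \<sigma>p :: "real \<Rightarrow> real \<Rightarrow> real"
    and \<sigma>0 \<xi>0 :: "real \<Rightarrow> real"
    and y \<xi> :: "real \<Rightarrow> real \<Rightarrow> real"
  defines "M \<equiv> lebesgue_on {a<..<b}"
    and "I \<equiv> {0..T}"
    and "\<sigma>t \<equiv> stress_solution a b C ua ub F"
    and "\<Sigma> \<equiv> yield_set (lebesgue_on {a<..<b}) \<sigma>m \<sigma>p"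
  assumes "a < b" and "T > 0"
    and C_meas: "C \<in> Linf M" and "0 < c0" and C_bounds: "AE x in M. c0 \<le> C x \<and> C x \<le> C0"
    and "ua \<in> W1inf I" and "ub \<in> W1inf I"
    and "\<And>t. t \<in> I \<Longrightarrow> t > 0 \<Longrightarrow> a + ua t < b + ub t"
    and "F \<in> W1inf_L2 I M"
    and yield_minus: "AE x in M. convex_on UNIV (\<sigma>m x) \<and>
           (strict_mono (\<sigma>m x) \<or> strict_antimono_on UNIV (\<sigma>m x)) \<and> surj (\<sigma>m x)"
    and yield_plus: "AE x in M. concave_on UNIV (\<sigma>p x) \<and>
           (strict_mono (\<sigma>p x) \<or> strict_antimono_on UNIV (\<sigma>p x)) \<and> surj (\<sigma>p x)"
    and hardening: "expanding_elastic_range M \<sigma>m \<sigma>p \<or> linear_kinematic_hardening M \<sigma>m \<sigma>p"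
    and init_mem: "(\<sigma>0 - \<sigma>t 0, \<xi>0) \<in> moving_set M \<Sigma> \<sigma>t 0"
    and init_strict: "AE x in M. \<sigma>m x (\<xi>0 x) < \<sigma>p x (\<xi>0 x)"
    and solution: "sweeping_solution M C I (moving_set M \<Sigma> \<sigma>t) y \<xi>"
    and init: "AE x in M. y 0 x = \<sigma>0 x - \<sigma>t 0 x \<and> \<xi> 0 x = \<xi>0 x"
  shows "AE t in lebesgue_on I. strain_rate_set M C I \<Sigma> \<sigma>t y \<xi> t \<noteq> {}"
proof -
  have fin: "finite_measure M"
    unfolding M_def by (intro finite_measure_lebesgue_on) simp
  have c0: "AE x in M. c0 \<le> C x"
    using C_bounds by eventually_elim simp
  have F: "F s \<in> L2 M" if "s \<in> I" for s
    using \<open>F \<in> W1inf_L2 I M\<close> that by (auto simp: W1inf_L2_def)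
  obtain G K where G: "AE t in lebesgue_on I.
      has_L2_derivative M (\<lambda>_. 1) I F (G t) t \<and> L2_norm M (\<lambda>_. 1) (G t) \<le> K"
    using \<open>F \<in> W1inf_L2 I M\<close> by (auto simp: W1inf_L2_def)
  have sol: "AE t in lebesgue_on I. \<exists>dy d\<xi>.
      has_L2_derivative M C I y dy t \<and> has_L2_derivative M (\<lambda>_. 1) I \<xi> d\<xi> t \<and>
      - (dy, d\<xi>) \<in> normal_cone M C (moving_set M \<Sigma> \<sigma>t t) (y t, \<xi> t)"
    using solution by (simp add: sweeping_solution_def)
  \<comment> \<open>At almost every \<open>t\<close> the boundary data, the load and the solution
    are differentiable together; \<open>AE_space\<close> adds \<open>t \<in> I\<close>.\<close>
  show ?thesis
    using W1inf_AE_derivative[OF \<open>ua \<in> W1inf I\<close>] W1inf_AE_derivative[OF \<open>ub \<in> W1inf I\<close>]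
      G sol AE_space
  proof eventually_elim
    case (elim t)
    from elim(1,2) obtain va vb where
      ua: "((\<lambda>s. (ua s - ua t) / (s - t) - va) \<longlongrightarrow> 0) (at t within I)" and
      ub: "((\<lambda>s. (ub s - ub t) / (s - t) - vb) \<longlongrightarrow> 0) (at t within I)"
      by blast
    from elim(4) obtain dy d\<xi> where dy: "has_L2_derivative M C I y dy t"
      and d\<xi>: "has_L2_derivative M (\<lambda>_. 1) I \<xi> d\<xi> t"
      and normal: "- (dy, d\<xi>) \<in> normal_cone M C (moving_set M \<Sigma> \<sigma>t t) (y t, \<xi> t)"
      by blast
    have t: "t \<in> I" using elim(5) by simp
    have d\<sigma>t: "has_L2_derivative M (\<lambda>_. 1) I \<sigma>t
        (stress_solution a b C (\<lambda>_. va) (\<lambda>_. vb) (\<lambda>_. G t) t) t"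
      unfolding \<sigma>t_def M_def
      by (rule stress_solution_L2_derivative[OF \<open>a < b\<close> C_meas[unfolded M_def] \<open>0 < c0\<close>
            c0[unfolded M_def] F[unfolded M_def] t ua ub])
        (use elim(3) in \<open>simp_all add: M_def\<close>)
    show ?case
      unfolding \<Sigma>_def M_def[symmetric]
      by (rule strain_rate_set_nonempty[OF fin C_meas \<open>0 < c0\<close> c0 yield_minus yield_plus hardening
            dy d\<xi> d\<sigma>t normal[unfolded \<Sigma>_def M_def[symmetric]]])
  qed
qed

end
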